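(* Let $n\ge 1$ and let $J$ be an almost complex structure defined on $\mathbb{C}^n$ that is Hölder continuous of class $\mathcal{C}^{1/2}$. Let $u:\mathbf{D}\to\mathbb{C}^n$ be a $J$-holomorphic map. If $u=0$ on some non-empty open subset of $\mathbf{D}$, then $u\equiv 0$ on $\mathbf{D}$.
   Context: $\mathbf{D}$ denotes the open unit disc in $\mathbb{C}$, with coordinate $z=x+iy$. An almost complex structure $J$ on $\mathbb{C}^n$ assigns to each $p\in\mathbb{C}^n$ an $\mathbb{R}$-linear endomorphism $J(p)$ of the real tangent space of $\mathbb{C}^n$ at $p$ (identified with $\mathbb{R}^{2n}$) satisfying $J(p)^2=-\mathbf{1}$. It is of class $\mathcal{C}^{1/2}$ if the matrix-valued map $p\mapsto J(p)$ is (locally) Hölder continuous with exponent $\tfrac12$. A map $u:\mathbf{D}\to\mathbb{C}^n$ of class $\mathcal{C}^1$ is $J$-holomorphic if $\frac{\partial u}{\partial y}(z)=[J(u(z))]\big(\frac{\partial u}{\partial x}(z)\big)$ for all $z\in\mathbf{D}$. (When $J$ is of class $\mathcal{C}^{1/2}$, such $u$ is automatically of class $\mathcal{C}^{1,1/2}$.) *)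

theory Defs
  imports "HOL-Analysis.Analysis"
begin

text \<open>
  \<open>\<complex>\<^sup>n\<close> is \<^typ>\<open>complex ^ 'n\<close>, and the real tangent space at each of its points is
  identified with the space itself. The type \<open>'a \<Rightarrow>\<^sub>L 'b\<close> consists of the bounded
  real-linear maps, that is, of all real-linear maps when \<open>'a\<close> is finite-dimensional;
  its operator norm is equivalent to any norm on matrices.
\<close>

definition almost_complex_structure ::
    "(complex ^ 'n \<Rightarrow> (complex ^ 'n) \<Rightarrow>\<^sub>L (complex ^ 'n)) \<Rightarrow> bool" where
  "almost_complex_structure J \<longleftrightarrow> (\<forall>p. J p o\<^sub>L J p = - id_blinfun)"

definition locally_holder_on ::
    "real \<Rightarrow> 'a::metric_space set \<Rightarrow> ('a \<Rightarrow> 'b::metric_space) \<Rightarrow> bool" where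
  "locally_holder_on \<alpha> S f \<longleftrightarrow>
     (\<forall>p\<in>S. \<exists>U C. open U \<and> p \<in> U \<and>
        (\<forall>x\<in>U \<inter> S. \<forall>y\<in>U \<inter> S. dist (f x) (f y) \<le> C * dist x y powr \<alpha>))"

text \<open>Intended for open sets only, since the derivative is the unrestricted one.\<close>

definition C1_on ::
    "'a::real_normed_vector set \<Rightarrow> ('a \<Rightarrow> 'b::real_normed_vector) \<Rightarrow> bool" where
  "C1_on S f \<longleftrightarrow>
     (\<exists>f' :: 'a \<Rightarrow> 'a \<Rightarrow>\<^sub>L 'b.
        (\<forall>x\<in>S. (f has_derivative blinfun_apply (f' x)) (at x)) \<and> continuous_on S f')"

definition partial_x :: "(complex \<Rightarrow> 'b::real_normed_vector) \<Rightarrow> complex \<Rightarrow> 'b" where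
  "partial_x u z = vector_derivative (\<lambda>t::real. u (z + complex_of_real t)) (at 0)"

definition partial_y :: "(complex \<Rightarrow> 'b::real_normed_vector) \<Rightarrow> complex \<Rightarrow> 'b" where
  "partial_y u z = vector_derivative (\<lambda>t::real. u (z + \<i> * complex_of_real t)) (at 0)"

definition J_holomorphic_on ::
    "(complex ^ 'n \<Rightarrow> (complex ^ 'n) \<Rightarrow>\<^sub>L (complex ^ 'n)) \<Rightarrow> complex set \<Rightarrow>
     (complex \<Rightarrow> complex ^ 'n) \<Rightarrow> bool" where
  "J_holomorphic_on J D u \<longleftrightarrow>
     C1_on D u \<and> (\<forall>z\<in>D. partial_y u z = blinfun_apply (J (u z)) (partial_x u z))"

end

theory Submission
  imports Defs
begin

text \<open>
  In suitable coordinates \<open>J(0)\<close> is multiplication by \<open>\<i>\<close>, and the Hoelder condition gives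
  \<open>\<bar>u\<^sub>y - \<i> u\<^sub>x\<bar>\<^sup>2 \<le> K \<bar>u\<bar> \<bar>u\<^sub>x\<bar>\<^sup>2\<close>. Suppose that \<open>u = 0\<close> on \<open>\<bar>z\<bar> < 1\<close> and \<open>\<bar>u\<bar> \<le> M\<close> on a larger
  disc. The Carleman estimate with the holomorphic weight \<open>z\<^sup>-\<^sup>N\<close> loses a factor \<open>N\<close> in the
  first derivatives, so the right-hand side can be absorbed as long as \<open>K M N\<^sup>2\<close> is small; with
  \<open>N\<close> of order \<open>M\<^sup>-\<^sup>1\<^sup>/\<^sup>2\<close> it bounds \<open>u\<close> by \<open>exp (- c \<delta> N)\<close>, hence by \<open>C \<delta>\<^sup>-\<^sup>4 M\<^sup>2\<close>, on the disc shrunk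
  by \<open>\<delta>\<close>. Iterating along discs decreasing to \<open>\<bar>z\<bar> < 3/2\<close> forces \<open>u = 0\<close> there once \<open>u\<close> is small
  enough. At a limit point \<open>p\<close> of the interior of the zero set the derivative of \<open>u\<close> vanishes, so
  rescaled maximal discs of zeros near \<open>p\<close> satisfy this smallness and could be enlarged.
\<close>

subsection \<open>Integral identities for compactly supported functions\<close>

text \<open>The partial derivatives are carried as explicit functions because cutoffs, weights and
  rescalings need formulas for them. The derivative is the unrestricted one, so \<open>S\<close> is
  meant to be open.\<close>

definition partials_on ::
    "complex set \<Rightarrow> (complex \<Rightarrow> 'b::real_normed_vector) \<Rightarrow> (complex \<Rightarrow> 'b) \<Rightarrow> (complex \<Rightarrow> 'b) \<Rightarrow> bool"
  where "partials_on S f fx fy \<longleftrightarrow>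
    (\<forall>z\<in>S. (f has_derivative (\<lambda>h. Re h *\<^sub>R fx z + Im h *\<^sub>R fy z)) (at z))
    \<and> continuous_on S fx \<and> continuous_on S fy"

lemma partials_onD:
  assumes "partials_on S f fx fy"
  shows "z \<in> S \<Longrightarrow> (f has_derivative (\<lambda>h. Re h *\<^sub>R fx z + Im h *\<^sub>R fy z)) (at z)"
    and "continuous_on S fx" "continuous_on S fy" "continuous_on S f"
proof -
  have D: "(f has_derivative (\<lambda>h. Re h *\<^sub>R fx z + Im h *\<^sub>R fy z)) (at z)" if "z \<in> S" for z
    using assms that by (auto simp: partials_on_def)
  then show "z \<in> S \<Longrightarrow> (f has_derivative (\<lambda>h. Re h *\<^sub>R fx z + Im h *\<^sub>R fy z)) (at z)" .
  show "continuous_on S fx" "continuous_on S fy"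
    using assms by (auto simp: partials_on_def)
  show "continuous_on S f"
    using has_derivative_continuous[OF D] by (intro continuous_at_imp_continuous_on) blast
qed

lemma partials_on_unique:
  assumes "(f has_derivative (\<lambda>h. Re h *\<^sub>R a + Im h *\<^sub>R b)) (at z)"
    and "(f has_derivative (\<lambda>h. Re h *\<^sub>R a' + Im h *\<^sub>R b')) (at z)"
  shows "a = a'" "b = b'"
proof -
  have "(\<lambda>h. Re h *\<^sub>R a + Im h *\<^sub>R b) = (\<lambda>h. Re h *\<^sub>R a' + Im h *\<^sub>R b')"
    using assms by (rule has_derivative_unique)
  from fun_cong[OF this, of 1] fun_cong[OF this, of \<i>] show "a = a'" "b = b'"
    by simp_all
qed

lemma partials_zero:
  assumes "(f has_derivative (\<lambda>h. Re h *\<^sub>R a + Im h *\<^sub>R b)) (at z)"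
    and "open S" "z \<in> S" "\<And>w. w \<in> S \<Longrightarrow> f w = 0"
  shows "a = 0" "b = 0"
proof -
  have "(f has_derivative (\<lambda>h. 0)) (at z)"
    by (rule has_derivative_transform_within_open[of "\<lambda>_. 0" _ _ _ S])
       (use assms in auto)
  then have "(f has_derivative (\<lambda>h. Re h *\<^sub>R 0 + Im h *\<^sub>R 0)) (at z)"
    by simp
  from partials_on_unique[OF assms(1) this] show "a = 0" "b = 0" .
qed

text \<open>Mean value inequality: each of the two terms of the differential has operator norm at
  most \<open>B\<close>, whence the factor 2.\<close>

lemma partials_on_norm_le:
  assumes f: "partials_on S f fx fy" and "convex S"
    and bx: "\<And>z. z \<in> S \<Longrightarrow> norm (fx z) \<le> B" and by': "\<And>z. z \<in> S \<Longrightarrow> norm (fy z) \<le> B"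
    and "x \<in> S" "y \<in> S"
  shows "norm (f x - f y) \<le> 2 * B * norm (x - y)"
proof (rule differentiable_bound[OF \<open>convex S\<close> _ _ \<open>x \<in> S\<close> \<open>y \<in> S\<close>])
  show "(f has_derivative (\<lambda>h. Re h *\<^sub>R fx z + Im h *\<^sub>R fy z)) (at z within S)" if "z \<in> S" for z
    using partials_onD(1)[OF f that] by (rule has_derivative_at_withinI)
  show "onorm (\<lambda>h. Re h *\<^sub>R fx z + Im h *\<^sub>R fy z) \<le> 2 * B" if "z \<in> S" for z
  proof (rule onorm_le)
    fix h
    have "norm (Re h *\<^sub>R fx z + Im h *\<^sub>R fy z) \<le> \<bar>Re h\<bar> * norm (fx z) + \<bar>Im h\<bar> * norm (fy z)"
      by (rule norm_triangle_le) simp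
    also have "\<dots> \<le> norm h * B + norm h * B"
      by (intro add_mono mult_mono bx by' that abs_Re_le_cmod abs_Im_le_cmod) auto
    finally show "norm (Re h *\<^sub>R fx z + Im h *\<^sub>R fy z) \<le> 2 * B * norm h"
      by simp
  qed
qed

section \<open>Lebesgue integrals of compactly supported functions\<close>

lemma integrable_compact_support:
  fixes f :: "'a::euclidean_space \<Rightarrow> 'b::{banach, second_countable_topology}"
  assumes "continuous_on UNIV f" "\<And>z. norm z > R \<Longrightarrow> f z = 0"
  shows "integrable lborel f"
proof -
  have "integrable lborel (\<lambda>x. indicator (cball 0 R) x *\<^sub>R f x)"
    using assms by (intro borel_integrable_compact) (auto intro: continuous_on_subset)
  also have "(\<lambda>x. indicator (cball 0 R) x *\<^sub>R f x) = f"
    using assms(2) by (auto simp: indicator_def fun_eq_iff)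
  finally show ?thesis .
qed

lemma lborel_integral_shift:
  fixes f :: "'a::euclidean_space \<Rightarrow> 'b::{banach, second_countable_topology}"
  assumes "continuous_on UNIV f"
  shows "integral\<^sup>L lborel (\<lambda>z. f (z + d)) = integral\<^sup>L lborel f"
proof -
  have [measurable]: "f \<in> borel_measurable borel"
    using assms by (rule borel_measurable_continuous_onI)
  have "integral\<^sup>L (distr lborel borel ((+) d)) f = integral\<^sup>L lborel (\<lambda>z. f (d + z))"
    by (rule integral_distr) auto
  then show ?thesis
    by (simp add: lborel_distr_plus add.commute)
qed

lemma bounded_compact_support:
  fixes f :: "complex \<Rightarrow> 'b::real_normed_vector"
  assumes "continuous_on UNIV f" "\<And>z. norm z > R \<Longrightarrow> f z = 0"
  obtains B where "B > 0" "\<And>z. norm (f z) \<le> B"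
proof -
  have "compact (f ` cball 0 R)"
    using assms(1) by (intro compact_continuous_image) (auto intro: continuous_on_subset)
  then obtain B where B: "B > 0" "\<And>z. z \<in> cball 0 R \<Longrightarrow> norm (f z) \<le> B"
    using compact_imp_bounded bounded_pos by (metis imageI)
  have "norm (f z) \<le> B" for z
    using B assms(2)[of z] by (cases "norm z \<le> R") auto
  with B that show ?thesis by blast
qed

lemma partials_compact_support:
  assumes f: "partials_on UNIV f fx fy" and "\<And>z. norm z > R \<Longrightarrow> f z = 0" and "norm z > R"
  shows "fx z = 0" "fy z = 0"
proof -
  have op: "open (- cball (0::complex) R)" by auto
  have "z \<in> - cball 0 R" "\<And>w. w \<in> - cball 0 R \<Longrightarrow> f w = 0" using assms by auto
  then show "fx z = 0" "fy z = 0"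
    using partials_zero[OF partials_onD(1)[OF f UNIV_I] op] by blast+
qed

section \<open>Difference quotients and their limits\<close>

lemma difference_quotient_tendsto:
  assumes D: "(f has_derivative (\<lambda>h. Re h *\<^sub>R a + Im h *\<^sub>R b)) (at z)"
    and X: "X \<longlonglongrightarrow> 0" and "\<And>n. X n \<noteq> (0::real)"
  shows "(\<lambda>n. (f (z + X n *\<^sub>R d) - f z) /\<^sub>R X n) \<longlonglongrightarrow> Re d *\<^sub>R a + Im d *\<^sub>R b"
proof -
  let ?L = "Re d *\<^sub>R a + Im d *\<^sub>R b"
  have 1: "((\<lambda>t::real. z + t *\<^sub>R d) has_derivative (\<lambda>t. t *\<^sub>R d)) (at 0)"
    by (auto intro!: derivative_eq_intros)
  have 2: "(f has_derivative (\<lambda>h. Re h *\<^sub>R a + Im h *\<^sub>R b)) (at (z + 0 *\<^sub>R d))"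
    using D by simp
  have "((\<lambda>t. f (z + t *\<^sub>R d)) has_derivative (\<lambda>t. t *\<^sub>R ?L)) (at 0)"
    using has_derivative_compose[OF 1 2] by (simp add: scaleR_add_right)
  then have "((\<lambda>t. norm (f (z + t *\<^sub>R d) - f z - t *\<^sub>R ?L) / norm t) \<longlongrightarrow> 0) (at 0)"
    by (simp add: has_derivative_at)
  then have "((\<lambda>t. norm ((f (z + t *\<^sub>R d) - f z) /\<^sub>R t - ?L)) \<longlongrightarrow> 0) (at 0)"
  proof (rule Lim_transform_eventually)
    have "norm (f (z + t *\<^sub>R d) - f z - t *\<^sub>R ?L) / norm t = norm ((f (z + t *\<^sub>R d) - f z) /\<^sub>R t - ?L)"
      if "t \<noteq> 0" for t
    proof -
      have "(f (z + t *\<^sub>R d) - f z) /\<^sub>R t - ?L = inverse t *\<^sub>R (f (z + t *\<^sub>R d) - f z - t *\<^sub>R ?L)"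
        using that by (simp add: scaleR_diff_right)
      then show ?thesis by (simp only: norm_scaleR) (simp add: divide_inverse mult.commute)
    qed
    then show "\<forall>\<^sub>F t in at 0. norm (f (z + t *\<^sub>R d) - f z - t *\<^sub>R ?L) / norm t
        = norm ((f (z + t *\<^sub>R d) - f z) /\<^sub>R t - ?L)"
      by (auto simp: eventually_at_filter)
  qed
  then have "((\<lambda>t. (f (z + t *\<^sub>R d) - f z) /\<^sub>R t) \<longlongrightarrow> ?L) (at 0)"
    by (rule LIM_zero_cancel[OF tendsto_norm_zero_cancel])
  moreover have "filterlim X (at 0) sequentially"
    using assms(2,3) by (simp add: filterlim_at)
  ultimately show ?thesis
    by (rule filterlim_compose)
qed

text \<open>The symmetric form matters: the product of the quotients in the directions 1 and
  \<open>\<i>\<close> expands into correlations whose integrals cancel in pairs.\<close>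

definition central_quotient :: "(complex \<Rightarrow> 'b::real_normed_vector) \<Rightarrow> complex \<Rightarrow> real \<Rightarrow> complex \<Rightarrow> 'b"
  where "central_quotient f d t z = (f (z + t *\<^sub>R d) - f (z - t *\<^sub>R d)) /\<^sub>R (2 * t)"

lemma central_quotient_tendsto:
  assumes "(f has_derivative (\<lambda>h. Re h *\<^sub>R a + Im h *\<^sub>R b)) (at z)"
    and X: "X \<longlonglongrightarrow> 0" and X0: "\<And>n. X n \<noteq> (0::real)"
  shows "(\<lambda>n. central_quotient f d (X n) z) \<longlonglongrightarrow> Re d *\<^sub>R a + Im d *\<^sub>R b"
proof -
  let ?q = "\<lambda>t. (f (z + t *\<^sub>R d) - f z) /\<^sub>R t"
  have "(\<lambda>n. - X n) \<longlonglongrightarrow> 0" using tendsto_minus[OF X] by simp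
  then have "(\<lambda>n. (1/2) *\<^sub>R (?q (X n) + ?q (- X n))) \<longlonglongrightarrow>
      (1/2) *\<^sub>R ((Re d *\<^sub>R a + Im d *\<^sub>R b) + (Re d *\<^sub>R a + Im d *\<^sub>R b))"
    using X0 X by (intro tendsto_intros difference_quotient_tendsto assms(1)) auto
  also have "(1/2) *\<^sub>R ((Re d *\<^sub>R a + Im d *\<^sub>R b) + (Re d *\<^sub>R a + Im d *\<^sub>R b)) = Re d *\<^sub>R a + Im d *\<^sub>R b"
    by (simp flip: scaleR_2)
  also have "(\<lambda>n. (1/2) *\<^sub>R (?q (X n) + ?q (- X n))) = (\<lambda>n. central_quotient f d (X n) z)"
    by (simp add: central_quotient_def fun_eq_iff algebra_simps)
  finally show ?thesis .
qed

lemma central_quotient_bound: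
  assumes f: "partials_on UNIV f fx fy"
    and B: "\<And>z. norm (fx z) \<le> B" "\<And>z. norm (fy z) \<le> B" and "t > 0" "norm d = 1"
  shows "norm (central_quotient f d t z) \<le> 2 * B"
proof -
  have "norm (f (z + t *\<^sub>R d) - f (z - t *\<^sub>R d)) \<le> 2 * B * norm ((z + t *\<^sub>R d) - (z - t *\<^sub>R d))"
    by (rule partials_on_norm_le[OF f convex_UNIV]) (use B in auto)
  also have "(z + t *\<^sub>R d) - (z - t *\<^sub>R d) = (2 * t) *\<^sub>R d"
    by (simp add: algebra_simps flip: scaleR_2)
  finally show ?thesis
    using assms(4,5) by (simp add: central_quotient_def divide_simps mult_ac)
qed

lemma central_quotient_eq_0:
  assumes "\<And>z. norm z > R \<Longrightarrow> f z = 0" "0 < t" "t \<le> 1" "norm d = 1" "norm z > R + 1"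
  shows "central_quotient f d t z = 0"
proof -
  have "norm z \<le> norm (z + t *\<^sub>R d) + norm (t *\<^sub>R d)" "norm z \<le> norm (z - t *\<^sub>R d) + norm (t *\<^sub>R d)"
    using norm_triangle_ineq4[of "z + t *\<^sub>R d" "t *\<^sub>R d"] norm_triangle_ineq[of "z - t *\<^sub>R d" "t *\<^sub>R d"]
    by simp_all
  then have "norm (z + t *\<^sub>R d) > R" "norm (z - t *\<^sub>R d) > R"
    using assms by simp_all
  then show ?thesis using assms(1) by (simp add: central_quotient_def)
qed

lemma central_quotient_continuous:
  assumes "continuous_on UNIV f" "t > 0"
  shows "continuous_on UNIV (central_quotient f d t)"
  unfolding central_quotient_def using assms
  by (auto intro!: continuous_intros continuous_on_compose2[of UNIV f])

lemma partials_bounded: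
  assumes f: "partials_on UNIV f fx fy" and sup: "\<And>z. norm z > R \<Longrightarrow> f z = 0"
  obtains B where "B > 0" "\<And>z. norm (fx z) \<le> B" "\<And>z. norm (fy z) \<le> B"
proof -
  note cont = partials_onD(2-4)[OF f]
  obtain B1 where B1: "B1 > 0" "\<And>z. norm (fx z) \<le> B1"
    using bounded_compact_support[of fx R] cont partials_compact_support[OF f sup] by metis
  obtain B2 where B2: "B2 > 0" "\<And>z. norm (fy z) \<le> B2"
    using bounded_compact_support[of fy R] cont partials_compact_support[OF f sup] by metis
  show ?thesis
    using B1(1) order_trans[OF B1(2), of "max B1 B2"] order_trans[OF B2(2), of "max B1 B2"]
    by (intro that[of "max B1 B2"]) auto
qed

text \<open>Dominated convergence, with \<open>B\<close> times the indicator of the common support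
  ball as dominating function.\<close>

lemma integral_tendsto_compact_support:
  fixes s :: "nat \<Rightarrow> complex \<Rightarrow> real"
  assumes "\<And>n. continuous_on UNIV (s n)" "continuous_on UNIV g"
    and "\<And>z. (\<lambda>n. s n z) \<longlonglongrightarrow> g z"
    and "\<And>n z. norm (s n z) \<le> B" "\<And>n z. norm z > R \<Longrightarrow> s n z = 0"
  shows "(\<lambda>n. integral\<^sup>L lborel (s n)) \<longlonglongrightarrow> integral\<^sup>L lborel g"
proof (rule integral_dominated_convergence[where w = "\<lambda>z. indicator (cball 0 R) z * B"])
  show "g \<in> borel_measurable lborel" "s n \<in> borel_measurable lborel" for n
    using assms(1,2) by (auto intro: borel_measurable_continuous_onI)
  show "integrable lborel (\<lambda>z::complex. indicator (cball 0 R) z * B)"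
    using borel_integrable_compact[OF compact_cball continuous_on_const, of "0::complex" R B]
    unfolding real_scaleR_def .
  show "AE z in lborel. norm (s n z) \<le> indicator (cball 0 R) z * B" for n
  proof (rule AE_I2)
    fix z
    show "norm (s n z) \<le> indicator (cball 0 R) z * B"
      using assms(4,5)[where n = n and z = z] by (cases "norm z \<le> R") auto
  qed
qed (use assms(3) in auto)

text \<open>Translation invariance of Lebesgue measure makes the integrals of the central quotients
  vanish, and dominated convergence carries this over to \<open>fx\<close>.\<close>

lemma integral_partial_x_eq_0:
  fixes f :: "complex \<Rightarrow> real"
  assumes f: "partials_on UNIV f fx fy" and sup: "\<And>z. norm z > R \<Longrightarrow> f z = 0"
  shows "integral\<^sup>L lborel fx = 0"
proof -
  note cont = partials_onD(2-4)[OF f]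
  obtain B where B: "B > 0" "\<And>z. norm (fx z) \<le> B" "\<And>z. norm (fy z) \<le> B"
    using partials_bounded[OF f sup] by blast
  define h where "h n = inverse (real (Suc n))" for n
  have h: "h n > 0" "h n \<le> 1" "h n \<noteq> 0" for n by (auto simp: h_def divide_simps)
  have h0: "h \<longlonglongrightarrow> 0" unfolding h_def by (rule LIMSEQ_inverse_real_of_nat)
  have int0: "integral\<^sup>L lborel (central_quotient f 1 (h n)) = 0" for n
  proof -
    have int: "integrable lborel (\<lambda>z. f (z + d))" for d
    proof (rule integrable_compact_support[where R = "R + norm d"])
      show "continuous_on UNIV (\<lambda>z. f (z + d))"
        using cont(3) by (auto intro!: continuous_on_compose2[of UNIV f] continuous_intros)
      show "f (z + d) = 0" if "R + norm d < norm z" for z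
        using that norm_triangle_ineq4[of "z + d" d] by (intro sup) simp
    qed
    have "central_quotient f 1 (h n) = (\<lambda>z. (f (z + h n *\<^sub>R 1) - f (z + - (h n *\<^sub>R 1))) /\<^sub>R (2 * h n))"
      by (simp add: central_quotient_def fun_eq_iff)
    then show ?thesis
      using int[of "h n *\<^sub>R 1"] int[of "- (h n *\<^sub>R 1)"] lborel_integral_shift[OF cont(3), of "h n *\<^sub>R 1"]
        lborel_integral_shift[OF cont(3), of "- (h n *\<^sub>R 1)"]
      by (simp del: add_uminus_conv_diff)
  qed
  have "(\<lambda>n. integral\<^sup>L lborel (central_quotient f 1 (h n))) \<longlonglongrightarrow> integral\<^sup>L lborel fx"
  proof (rule integral_tendsto_compact_support)
    show "(\<lambda>n. central_quotient f 1 (h n) z) \<longlonglongrightarrow> fx z" for z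
      using central_quotient_tendsto[OF partials_onD(1)[OF f UNIV_I] h0 h(3), of 1] by simp
    show "norm (central_quotient f 1 (h n) z) \<le> 2 * B" for n z
      by (rule central_quotient_bound[OF f B(2,3)]) (use h in auto)
    show "central_quotient f 1 (h n) z = 0" if "R + 1 < norm z" for n z
      using sup by (rule central_quotient_eq_0) (use h that in auto)
  qed (use cont central_quotient_continuous h in auto)
  then show ?thesis
    by (simp add: int0 LIMSEQ_const_iff)
qed

text \<open>Central differences satisfy this identity exactly, so that no second derivatives of \<open>w\<close>
  are needed.\<close>

lemma integral_jacobian_eq_0:
  fixes w :: "complex \<Rightarrow> complex"
  assumes w: "partials_on UNIV w wx wy" and sup: "\<And>z. norm z > R \<Longrightarrow> w z = 0"
  shows "integral\<^sup>L lborel (\<lambda>z. Im (wy z * cnj (wx z))) = 0"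
proof -
  note cont = partials_onD(2-4)[OF w]
  obtain B where B: "B > 0" "\<And>z. norm (wx z) \<le> B" "\<And>z. norm (wy z) \<le> B"
    using partials_bounded[OF w sup] by blast
  define h where "h n = inverse (real (Suc n))" for n
  have h: "h n > 0" "h n \<le> 1" "h n \<noteq> 0" for n by (auto simp: h_def divide_simps)
  have h0: "h \<longlonglongrightarrow> 0" unfolding h_def by (rule LIMSEQ_inverse_real_of_nat)
  define s where "s n z = Im (central_quotient w \<i> (h n) z * cnj (central_quotient w 1 (h n) z))" for n z
  define F where "F a z = Im (w z * cnj (w (z + a)))" for a z
  have contF: "continuous_on UNIV (F a)" for a
    unfolding F_def using cont(3) by (auto intro!: continuous_intros continuous_on_compose2[of UNIV w])
  define C where "C a = integral\<^sup>L lborel (F a)" for a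
  \<comment> \<open>Translating by \<open>a\<close> swaps the two factors, and conjugation changes
    the sign of the imaginary part, so the correlation \<open>C\<close> is odd.\<close>
  have C_minus: "C (- a) = - C a" for a
  proof -
    have "C (- a) = integral\<^sup>L lborel (\<lambda>z. F (- a) (z + a))"
      unfolding C_def by (rule lborel_integral_shift[OF contF, symmetric])
    also have "(\<lambda>z. F (- a) (z + a)) = (\<lambda>z. - F a z)"
      by (simp add: F_def fun_eq_iff mult.commute)
    finally show ?thesis by (simp add: C_def)
  qed
  have int0: "integral\<^sup>L lborel (s n) = 0" for n
  proof -
    define a where "a = h n *\<^sub>R (1::complex)"
    define b where "b = h n *\<^sub>R \<i>"
    have intF: "integrable lborel (\<lambda>z. F d (z + e))" for d e
    proof (rule integrable_compact_support[where R = "R + norm e"])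
      show "continuous_on UNIV (\<lambda>z. F d (z + e))"
        by (rule continuous_on_compose2[OF contF]) (auto intro!: continuous_intros)
      show "F d (z + e) = 0" if "R + norm e < norm z" for z
        using that norm_triangle_ineq4[of "z + e" e] sup[of "z + e"] by (simp add: F_def)
    qed
    \<comment> \<open>Each of the four terms of the product is a translate of some
      \<open>F d\<close>, where \<open>d\<close> is the difference of the two shifts.\<close>
    have "s n z = (F (a - b) (z + b) - F (- a - b) (z + b) - F (a + b) (z + - b) + F (b - a) (z + - b))
        / (2 * h n)\<^sup>2" for z
    proof -
      have scale: "Im ((p /\<^sub>R t) * cnj (q /\<^sub>R t)) = Im (p * cnj q) / t\<^sup>2" for p q :: complex and t :: real
        by (simp add: power2_eq_square divide_inverse algebra_simps)
      have "F (a - b) (z + b) = Im (w (z + b) * cnj (w (z + a)))"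
        "F (- a - b) (z + b) = Im (w (z + b) * cnj (w (z - a)))"
        "F (a + b) (z + - b) = Im (w (z - b) * cnj (w (z + a)))"
        "F (b - a) (z + - b) = Im (w (z - b) * cnj (w (z - a)))"
        by (simp_all add: F_def)
      moreover have "s n z = Im ((w (z + b) - w (z - b)) * cnj (w (z + a) - w (z - a))) / (2 * h n)\<^sup>2"
        unfolding s_def central_quotient_def scale by (simp only: a_def b_def)
      moreover have "Im ((p - q) * cnj (p' - q')) = Im (p * cnj p') - Im (p * cnj q') - Im (q * cnj p') + Im (q * cnj q')"
        for p q p' q' by (simp add: algebra_simps)
      ultimately show ?thesis by simp
    qed
    then have "s n = (\<lambda>z. (F (a - b) (z + b) - F (- a - b) (z + b) - F (a + b) (z + - b) + F (b - a) (z + - b))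
        / (2 * h n)\<^sup>2)" by blast
    then have "integral\<^sup>L lborel (s n) = (C (a - b) - C (- a - b) - C (a + b) + C (b - a)) / (2 * h n)\<^sup>2"
      by (simp add: intF lborel_integral_shift[OF contF] C_def del: add_uminus_conv_diff)
    \<comment> \<open>By oddness the first correlation cancels the last, and the two middle ones
      cancel each other.\<close>
    moreover have "C (b - a) = - C (a - b)" "C (- a - b) = - C (a + b)"
      using C_minus[of "a - b"] C_minus[of "a + b"] by simp_all
    ultimately show ?thesis by simp
  qed
  have "(\<lambda>n. integral\<^sup>L lborel (s n)) \<longlonglongrightarrow> integral\<^sup>L lborel (\<lambda>z. Im (wy z * cnj (wx z)))"
  proof (rule integral_tendsto_compact_support)
    show "continuous_on UNIV (s n)" for n
      unfolding s_def using h cont(3) by (auto intro!: continuous_intros central_quotient_continuous)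
    show "continuous_on UNIV (\<lambda>z. Im (wy z * cnj (wx z)))"
      using cont by (auto intro!: continuous_intros)
    note lim = central_quotient_tendsto[OF partials_onD(1)[OF w UNIV_I] h0 h(3)]
    show "(\<lambda>n. s n z) \<longlonglongrightarrow> Im (wy z * cnj (wx z))" for z
      unfolding s_def using lim[of 1 z] lim[of \<i> z] by (auto intro!: tendsto_intros)
    show "norm (s n z) \<le> (2 * B) * (2 * B)" for n z
    proof -
      have "norm (s n z) \<le> norm (central_quotient w \<i> (h n) z) * norm (central_quotient w 1 (h n) z)"
        unfolding s_def real_norm_def by (rule order_trans[OF abs_Im_le_cmod]) (simp add: norm_mult)
      also have "\<dots> \<le> (2 * B) * (2 * B)"
        using B(1) h by (intro mult_mono central_quotient_bound[OF w B(2,3)]) auto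
      finally show ?thesis .
    qed
    show "s n z = 0" if "R + 1 < norm z" for n z
      using central_quotient_eq_0[of R w "h n" 1 z] sup h that by (simp add: s_def)
  qed
  then show ?thesis
    by (simp add: int0 LIMSEQ_const_iff)
qed

section \<open>Calculus with explicit partial derivatives\<close>

lemma partials_on_subset: "partials_on S f fx fy \<Longrightarrow> T \<subseteq> S \<Longrightarrow> partials_on T f fx fy"
  unfolding partials_on_def by (blast intro: continuous_on_subset)

lemma partials_on_open_Un:
  assumes "partials_on S f fx fy" "partials_on T f fx fy" "open S" "open T"
  shows "partials_on (S \<union> T) f fx fy"
  using assms unfolding partials_on_def by (blast intro: continuous_on_open_Un)

lemma partials_on_cong:
  assumes f: "partials_on S f fx fy" and "open S"
    and "\<And>z. z \<in> S \<Longrightarrow> f z = g z" "\<And>z. z \<in> S \<Longrightarrow> fx z = gx z" "\<And>z. z \<in> S \<Longrightarrow> fy z = gy z"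
  shows "partials_on S g gx gy"
proof -
  have "(g has_derivative (\<lambda>h. Re h *\<^sub>R gx z + Im h *\<^sub>R gy z)) (at z)" if "z \<in> S" for z
    using has_derivative_transform_within_open[OF partials_onD(1)[OF f that] \<open>open S\<close> that, of g] assms that
    by simp
  moreover have "continuous_on S gx" "continuous_on S gy"
    using partials_onD(2,3)[OF f] assms(4,5) by (simp_all cong: continuous_on_cong)
  ultimately show ?thesis by (simp add: partials_on_def)
qed

lemma partials_on_zero: "partials_on S (\<lambda>_. 0) (\<lambda>_. 0) (\<lambda>_. 0)"
  by (simp add: partials_on_def)

lemma partials_on_mult:
  fixes f g :: "complex \<Rightarrow> 'a::real_normed_algebra"
  assumes f: "partials_on S f fx fy" and g: "partials_on S g gx gy"
  shows "partials_on S (\<lambda>z. f z * g z) (\<lambda>z. f z * gx z + fx z * g z) (\<lambda>z. f z * gy z + fy z * g z)"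
  unfolding partials_on_def
proof (intro conjI ballI)
  show "((\<lambda>z. f z * g z) has_derivative
      (\<lambda>h. Re h *\<^sub>R (f z * gx z + fx z * g z) + Im h *\<^sub>R (f z * gy z + fy z * g z))) (at z)" if "z \<in> S" for z
    using has_derivative_mult[OF partials_onD(1)[OF f that] partials_onD(1)[OF g that]]
    by (simp add: algebra_simps)
qed (use partials_onD(2-4)[OF f] partials_onD(2-4)[OF g] in \<open>auto intro!: continuous_intros\<close>)

lemma partials_on_of_real:
  assumes f: "partials_on S f fx fy"
  shows "partials_on S (\<lambda>z. complex_of_real (f z)) (\<lambda>z. of_real (fx z)) (\<lambda>z. of_real (fy z))"
  unfolding partials_on_def
proof (intro conjI ballI)
  show "((\<lambda>z. complex_of_real (f z)) has_derivative
      (\<lambda>h. Re h *\<^sub>R of_real (fx z) + Im h *\<^sub>R of_real (fy z))) (at z)" if "z \<in> S" for z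
    using has_derivative_of_real[OF partials_onD(1)[OF f that], where 'a = complex]
    by (simp add: scaleR_conv_of_real)
qed (use partials_onD(2-4)[OF f] in \<open>auto intro!: continuous_intros\<close>)

lemma partials_on_holomorphic:
  assumes "\<And>z. z \<in> S \<Longrightarrow> (f has_field_derivative f' z) (at z)" and "continuous_on S f'"
  shows "partials_on S f f' (\<lambda>z. \<i> * f' z)"
  unfolding partials_on_def
proof (intro conjI ballI)
  show "(f has_derivative (\<lambda>h. Re h *\<^sub>R f' z + Im h *\<^sub>R (\<i> * f' z))) (at z)" if "z \<in> S" for z
  proof -
    have "(\<lambda>h. Re h *\<^sub>R f' z + Im h *\<^sub>R (\<i> * f' z)) = (*) (f' z)"
      by (auto simp: fun_eq_iff complex_eq_iff algebra_simps)
    then show ?thesis using assms(1)[OF that] by (simp add: has_field_derivative_def)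
  qed
qed (use assms in \<open>auto intro!: continuous_intros\<close>)

text \<open>Expanding the square on the right gives |wx|^2 + |wy|^2 minus twice the Jacobian term,
  whose integral is 0.\<close>

lemma integral_norm_partial_le_dbar:
  assumes w: "partials_on UNIV w wx wy" and sup: "\<And>z. norm z > R \<Longrightarrow> w z = 0"
  shows "(\<integral>z. (cmod (wx z))\<^sup>2 \<partial>lborel) \<le> (\<integral>z. (cmod (wy z - \<i> * wx z))\<^sup>2 \<partial>lborel)"
proof -
  note cont = partials_onD(2-4)[OF w]
  have eq: "(cmod (wy z - \<i> * wx z))\<^sup>2 + 2 * Im (wy z * cnj (wx z)) = (cmod (wx z))\<^sup>2 + (cmod (wy z))\<^sup>2" for z
    unfolding cmod_power2 by (simp add: power2_eq_square algebra_simps)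
  have int: "integrable lborel (\<lambda>z. (cmod (wy z - \<i> * wx z))\<^sup>2)" "integrable lborel (\<lambda>z. (cmod (wx z))\<^sup>2)"
    "integrable lborel (\<lambda>z. (cmod (wy z))\<^sup>2)" "integrable lborel (\<lambda>z. 2 * Im (wy z * cnj (wx z)))"
    by (rule integrable_compact_support[where R = R];
        use cont partials_compact_support[OF w sup] in \<open>auto intro!: continuous_intros\<close>)+
  have "(\<integral>z. Im (wy z * cnj (wx z)) \<partial>lborel) = 0"
    by (rule integral_jacobian_eq_0[OF w sup])
  then have "(\<integral>z. 2 * Im (wy z * cnj (wx z)) \<partial>lborel) = 0"
    by (simp only: integral_mult_right_zero)
  then have "(\<integral>z. (cmod (wy z - \<i> * wx z))\<^sup>2 \<partial>lborel)
      = (\<integral>z. (cmod (wy z - \<i> * wx z))\<^sup>2 + 2 * Im (wy z * cnj (wx z)) \<partial>lborel)"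
    by (simp only: Bochner_Integration.integral_add[OF int(1) int(4)] add_0_right)
  also have "\<dots> = (\<integral>z. (cmod (wx z))\<^sup>2 \<partial>lborel) + (\<integral>z. (cmod (wy z))\<^sup>2 \<partial>lborel)"
    unfolding eq using int by simp
  finally show ?thesis by simp
qed

text \<open>The x-derivative of Re z * |w|^2 has integral 0, which turns the integral of |w|^2 into
  that of the mixed term \<open>- g\<close>. Half of the resulting bound is absorbed on the
  left.\<close>

lemma poincare_compact_support:
  assumes w: "partials_on UNIV w wx wy" and sup: "\<And>z. norm z > R \<Longrightarrow> w z = 0" and "R \<ge> 0"
  shows "(\<integral>z. (cmod (w z))\<^sup>2 \<partial>lborel) \<le> 4 * R\<^sup>2 * (\<integral>z. (cmod (wx z))\<^sup>2 \<partial>lborel)"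
proof -
  note cont = partials_onD(2-4)[OF w]
  define g where "g z = 2 * Re z * Re (w z * cnj (wx z))" for z
  have f: "partials_on UNIV (\<lambda>z. Re z * (cmod (w z))\<^sup>2) (\<lambda>z. (cmod (w z))\<^sup>2 + g z)
     (\<lambda>z. 2 * Re z * Re (w z * cnj (wy z)))"
    unfolding partials_on_def
  proof (intro conjI ballI)
    show "((\<lambda>z. Re z * (cmod (w z))\<^sup>2) has_derivative
      (\<lambda>h. Re h *\<^sub>R ((cmod (w z))\<^sup>2 + g z) + Im h *\<^sub>R (2 * Re z * Re (w z * cnj (wy z))))) (at z)" for z
      unfolding cmod_power2 g_def using partials_onD(1)[OF w UNIV_I, of z]
      by (auto intro!: derivative_eq_intros simp: fun_eq_iff algebra_simps power2_eq_square)
  qed (use cont in \<open>auto intro!: continuous_intros simp: g_def\<close>)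
  have "(\<integral>z. (cmod (w z))\<^sup>2 + g z \<partial>lborel) = 0"
    by (rule integral_partial_x_eq_0[OF f]) (use sup in auto)
  moreover have int: "integrable lborel (\<lambda>z. (cmod (w z))\<^sup>2)" "integrable lborel (\<lambda>z. (cmod (wx z))\<^sup>2)"
     "integrable lborel g"
    unfolding g_def by (rule integrable_compact_support[where R = R];
        use cont sup partials_compact_support[OF w sup] in \<open>auto intro!: continuous_intros\<close>)+
  ultimately have "(\<integral>z. (cmod (w z))\<^sup>2 \<partial>lborel) = (\<integral>z. - g z \<partial>lborel)"
    by simp
  also have "\<dots> \<le> (\<integral>z. (1/2) * (cmod (w z))\<^sup>2 + 2 * R\<^sup>2 * (cmod (wx z))\<^sup>2 \<partial>lborel)"
  proof (rule integral_mono)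
    show "- g z \<le> (1/2) * (cmod (w z))\<^sup>2 + 2 * R\<^sup>2 * (cmod (wx z))\<^sup>2" for z
    proof (cases "norm z \<le> R")
      case True
      have "\<bar>Re z\<bar> \<le> R" using True abs_Re_le_cmod[of z] by linarith
      moreover have "\<bar>Re (w z * cnj (wx z))\<bar> \<le> cmod (w z) * cmod (wx z)"
        by (rule order_trans[OF abs_Re_le_cmod]) (simp add: norm_mult)
      ultimately have "\<bar>g z\<bar> \<le> 2 * R * (cmod (w z) * cmod (wx z))"
        unfolding g_def abs_mult using assms(3) by (intro mult_mono) auto
      \<comment> \<open>The square is weighted so that |w|^2 receives the coefficient 1/2.\<close>
      moreover have "0 \<le> (cmod (w z) - 2 * R * cmod (wx z))\<^sup>2" by simp
      ultimately show ?thesis by (simp add: power2_eq_square algebra_simps)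
    next
      case False
      then show ?thesis using sup[of z] by (simp add: g_def)
    qed
  qed (use int in auto)
  also have "\<dots> = (1/2) * (\<integral>z. (cmod (w z))\<^sup>2 \<partial>lborel) + 2 * R\<^sup>2 * (\<integral>z. (cmod (wx z))\<^sup>2 \<partial>lborel)"
    using int by simp
  finally show ?thesis by simp
qed

subsection \<open>The Carleman estimate\<close>

lemma has_real_derivative_max_0_square:
  "((\<lambda>t::real. (max 0 t)\<^sup>2) has_real_derivative 2 * max 0 t) (at t)"
proof -
  consider "t > 0" | "t < 0" | "t = 0" by linarith
  then show ?thesis
  proof cases
    case 1
    have "((\<lambda>t::real. t\<^sup>2) has_real_derivative 2 * max 0 t) (at t)"
      using 1 by (auto intro!: derivative_eq_intros)
    then show ?thesis
      by (rule has_field_derivative_transform_within_open[where S = "{0<..}"]) (use 1 in auto)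
  next
    case 2
    have "((\<lambda>t::real. 0) has_real_derivative 2 * max 0 t) (at t)"
      using 2 by auto
    then show ?thesis
      by (rule has_field_derivative_transform_within_open[where S = "{..<0}"]) (use 2 in auto)
  next
    case 3
    have "((\<lambda>h::real. (max 0 h)\<^sup>2 / h) \<longlongrightarrow> 0) (at 0)"
    proof (rule Lim_null_comparison)
      show "\<forall>\<^sub>F h::real in at 0. norm ((max 0 h)\<^sup>2 / h) \<le> norm h"
        by (auto simp: max_def power2_eq_square abs_mult intro!: always_eventually)
      show "((\<lambda>h::real. norm h) \<longlongrightarrow> 0) (at 0)"
        by (intro tendsto_norm_zero tendsto_ident_at)
    qed
    then show ?thesis using 3 by (simp add: DERIV_def)
  qed
qed

text \<open>A quadratic spline rising from 0 to 1 on the unit interval. Its derivative is the tent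
  function with peak value 2 at 1/2, so it is continuously differentiable, as
  \<open>partials_on\<close> requires.\<close>

definition smooth_step :: "real \<Rightarrow> real"
  where "smooth_step t = 2 * ((max 0 t)\<^sup>2 - 2 * (max 0 (t - 1/2))\<^sup>2 + (max 0 (t - 1))\<^sup>2)"

definition smooth_step_deriv :: "real \<Rightarrow> real"
  where "smooth_step_deriv t = 4 * (max 0 t - 2 * max 0 (t - 1/2) + max 0 (t - 1))"

lemma smooth_step_has_derivative:
  "(smooth_step has_real_derivative smooth_step_deriv t) (at t)"
proof -
  have 1: "((\<lambda>t. (max 0 (t - c))\<^sup>2) has_real_derivative 2 * max 0 (t - c)) (at t)" for c
  proof -
    have "((\<lambda>t. t - c) has_real_derivative 1) (at t)"
      by (auto intro!: derivative_eq_intros)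
    from DERIV_chain2[OF has_real_derivative_max_0_square this] show ?thesis by simp
  qed
  show ?thesis
    unfolding smooth_step_def[abs_def] smooth_step_deriv_def
    by (rule derivative_eq_intros 1 has_real_derivative_max_0_square refl)+ simp
qed

lemma smooth_step_eq:
  "t \<le> 0 \<Longrightarrow> smooth_step t = 0" "t \<ge> 1 \<Longrightarrow> smooth_step t = 1"
  by (auto simp: smooth_step_def max_def power2_eq_square algebra_simps)

lemma smooth_step_deriv_bounds:
  "\<bar>smooth_step_deriv t\<bar> \<le> 2" "t \<le> 0 \<Longrightarrow> smooth_step_deriv t = 0" "t \<ge> 1 \<Longrightarrow> smooth_step_deriv t = 0"
  by (auto simp: smooth_step_deriv_def max_def abs_if)

text \<open>The step function is composed with an affine function of |z|^2, which is differentiable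
  at the origin as well.\<close>

lemma radial_cutoff_exists:
  assumes "1 \<le> r" "r < s" "s \<le> 2"
  obtains \<phi> \<phi>x \<phi>y :: "complex \<Rightarrow> real" where "partials_on UNIV \<phi> \<phi>x \<phi>y"
    "\<And>z. norm z \<le> r \<Longrightarrow> \<phi> z = 1" "\<And>z. norm z \<ge> s \<Longrightarrow> \<phi> z = 0"
    "\<And>z. norm z \<le> r \<Longrightarrow> \<phi>x z = 0" "\<And>z. norm z \<le> r \<Longrightarrow> \<phi>y z = 0"
    "\<And>z. \<bar>\<phi>x z\<bar> \<le> 4 / (s - r)" "\<And>z. \<bar>\<phi>y z\<bar> \<le> 4 / (s - r)"
proof -
  define c where "c = s\<^sup>2 - r\<^sup>2"
  have "c = (s - r) * (s + r)" by (simp add: c_def power2_eq_square algebra_simps)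
  moreover have "(s - r) * (s + r) \<ge> (s - r) * 2" using assms by (intro mult_left_mono) auto
  ultimately have c: "c \<ge> 2 * (s - r)" "c > 0" using assms by auto
  define \<tau> where "\<tau> z = ((Re z)\<^sup>2 + (Im z)\<^sup>2 - r\<^sup>2) / c" for z
  have \<tau>_le: "\<tau> z \<le> 0" if "norm z \<le> r" for z
    using that c power_mono[OF that, of 2]
    by (auto simp: \<tau>_def cmod_power2 divide_le_0_iff)
  have \<tau>_ge: "\<tau> z \<ge> 1" if "norm z \<ge> s" for z
    using that c assms power_mono[OF that, of 2]
    by (auto simp: \<tau>_def cmod_power2 le_divide_eq c_def)
  define \<phi> where "\<phi> z = 1 - smooth_step (\<tau> z)" for z
  define \<phi>x where "\<phi>x z = - smooth_step_deriv (\<tau> z) * (2 * Re z / c)" for z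
  define \<phi>y where "\<phi>y z = - smooth_step_deriv (\<tau> z) * (2 * Im z / c)" for z
  have bound: "\<bar>smooth_step_deriv (\<tau> z) * (2 * x / c)\<bar> \<le> 4 / (s - r)" if "\<bar>x\<bar> \<le> norm z" for x z
  proof (cases "norm z \<ge> s")
    case True
    then show ?thesis using \<tau>_ge smooth_step_deriv_bounds(3) assms by simp
  next
    case False
    have "\<bar>smooth_step_deriv (\<tau> z) * (2 * x / c)\<bar> = \<bar>smooth_step_deriv (\<tau> z)\<bar> * (2 * \<bar>x\<bar> / c)"
      using c by (simp add: abs_mult)
    \<comment> \<open>The ingredients are the slope bound 2 of the step,
      \<open>\<bar>x\<bar> < s \<le> 2\<close>, and \<open>c \<ge> 2 * (s - r)\<close>.\<close>
    also have "\<dots> \<le> 2 * (4 / (2 * (s - r)))"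
      using False that assms c
      by (intro mult_mono frac_le smooth_step_deriv_bounds) auto
    also have "\<dots> = 4 / (s - r)" using assms by (simp add: divide_simps)
    finally show ?thesis .
  qed
  have "partials_on UNIV \<phi> \<phi>x \<phi>y"
    unfolding partials_on_def
  proof (intro conjI ballI)
    fix z :: complex
    have "(\<tau> has_derivative (\<lambda>h. (2 * Re z * Re h + 2 * Im z * Im h) / c)) (at z)"
      unfolding \<tau>_def[abs_def] using c
      by (auto intro!: derivative_eq_intros simp: fun_eq_iff field_simps)
    from has_derivative_compose[OF this smooth_step_has_derivative[of "\<tau> z", unfolded has_field_derivative_def]]
    have "((\<lambda>z. smooth_step (\<tau> z)) has_derivative
        (\<lambda>h. smooth_step_deriv (\<tau> z) * ((2 * Re z * Re h + 2 * Im z * Im h) / c))) (at z)" .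
    then show "(\<phi> has_derivative (\<lambda>h. Re h *\<^sub>R \<phi>x z + Im h *\<^sub>R \<phi>y z)) (at z)"
      unfolding \<phi>_def[abs_def] \<phi>x_def \<phi>y_def using c
      by (auto intro!: derivative_eq_intros simp: fun_eq_iff field_simps)
  next
    have "continuous_on UNIV smooth_step_deriv"
      unfolding smooth_step_deriv_def[abs_def] by (intro continuous_intros)
    moreover have "continuous_on UNIV \<tau>"
      unfolding \<tau>_def[abs_def] using c by (intro continuous_intros) auto
    ultimately have "continuous_on UNIV (\<lambda>z. smooth_step_deriv (\<tau> z))"
      by (rule continuous_on_compose2) auto
    then show "continuous_on UNIV \<phi>x" "continuous_on UNIV \<phi>y"
      unfolding \<phi>x_def[abs_def] \<phi>y_def[abs_def] using c by (auto intro!: continuous_intros)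
  qed
  moreover have "\<bar>\<phi>x z\<bar> \<le> 4 / (s - r)" "\<bar>\<phi>y z\<bar> \<le> 4 / (s - r)" for z
    using bound[OF abs_Re_le_cmod] bound[OF abs_Im_le_cmod] by (simp_all add: \<phi>x_def \<phi>y_def)
  ultimately show ?thesis
    using \<tau>_le \<tau>_ge
    by (intro that[of \<phi> \<phi>x \<phi>y]) (auto simp: \<phi>_def \<phi>x_def \<phi>y_def smooth_step_eq smooth_step_deriv_bounds)
qed

section \<open>The holomorphic weight and the absorption argument\<close>

lemma sum_power2_le:
  fixes a b c :: real
  shows "(a + b)\<^sup>2 \<le> 2 * a\<^sup>2 + 2 * b\<^sup>2" "(a + b + c)\<^sup>2 \<le> 3 * a\<^sup>2 + 3 * b\<^sup>2 + 3 * c\<^sup>2"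
proof -
  have "0 \<le> (a - b)\<^sup>2" "0 \<le> (a - b)\<^sup>2 + (a - c)\<^sup>2 + (b - c)\<^sup>2" by simp_all
  then show "(a + b)\<^sup>2 \<le> 2 * a\<^sup>2 + 2 * b\<^sup>2" "(a + b + c)\<^sup>2 \<le> 3 * a\<^sup>2 + 3 * b\<^sup>2 + 3 * c\<^sup>2"
    by (simp_all add: power2_eq_square algebra_simps)
qed

text \<open>The weight \<open>z\<^sup>-\<^sup>N\<close> is holomorphic, so it commutes with the Cauchy-Riemann operator
  \<open>\<partial>\<^sub>y - \<i> \<partial>\<^sub>x\<close>, and its derivative costs only a factor \<open>N\<close> on \<open>\<bar>z\<bar> \<ge> 1\<close>.\<close>

lemma weighted_cutoff_partials:
  assumes W: "partials_on (ball 0 \<rho>) W Wx Wy" and W0: "\<And>z. norm z < 1 \<Longrightarrow> W z = 0"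
    and \<phi>: "partials_on UNIV \<phi> \<phi>x \<phi>y" "\<And>z. norm z \<ge> s \<Longrightarrow> \<phi> z = 0" and "1 < s" "s < \<rho>"
    and \<phi>0: "\<And>z. norm z \<le> 1 \<Longrightarrow> \<phi>x z = 0" "\<And>z. norm z \<le> 1 \<Longrightarrow> \<phi>y z = 0"
  shows "\<exists>w wx wy. partials_on UNIV w wx wy \<and> (\<forall>z. norm z > s \<longrightarrow> w z = 0) \<and>
    (\<forall>z. norm z < \<rho> \<longrightarrow> w z = of_real (\<phi> z) * (inverse z ^ N * W z)) \<and>
    (\<forall>z. norm z < 1 \<or> \<rho> \<le> norm z \<longrightarrow> wy z - \<i> * wx z = 0) \<and>
    (\<forall>z. 1 \<le> norm z \<longrightarrow> norm z < \<rho> \<longrightarrow>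
      wy z - \<i> * wx z = of_real (\<phi> z) * (inverse z ^ N * (Wy z - \<i> * Wx z))
        + (of_real (\<phi>y z) - \<i> * of_real (\<phi>x z)) * (inverse z ^ N * W z)) \<and>
    (\<forall>z. 1 \<le> norm z \<longrightarrow> norm z < \<rho> \<longrightarrow>
      of_real (\<phi> z) * (inverse z ^ N * Wx z)
        = wx z + of_nat N * inverse z * w z - of_real (\<phi>x z) * (inverse z ^ N * W z))"
proof -
  define p where "p z = inverse z ^ N" for z :: complex
  define p' where "p' z = - (of_nat N * inverse z ^ Suc N)" for z :: complex
  \<comment> \<open>\<open>W\<close> is known only on the ball of radius \<open>\<rho>\<close>, so
    the product is extended by 0; the cutoff vanishes from radius \<open>s\<close> on. The partials
    are also set to 0 on the unit disc, where \<open>W\<close> vanishes.\<close>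
  define w where "w z = (if norm z < \<rho> then of_real (\<phi> z) * (p z * W z) else 0)" for z
  define wx where "wx z = (if 1 \<le> norm z \<and> norm z < \<rho>
    then of_real (\<phi> z) * (p z * Wx z + p' z * W z) + of_real (\<phi>x z) * (p z * W z) else 0)" for z
  define wy where "wy z = (if 1 \<le> norm z \<and> norm z < \<rho>
    then of_real (\<phi> z) * (p z * Wy z + \<i> * p' z * W z) + of_real (\<phi>y z) * (p z * W z) else 0)" for z
  define A where "A = ball (0::complex) \<rho> - {0}"
  have p: "partials_on A p p' (\<lambda>z. \<i> * p' z)"
  proof (rule partials_on_holomorphic)
    show "(p has_field_derivative p' z) (at z)" if "z \<in> A" for z
    proof -
      have [simp]: "z \<noteq> 0" using that by (auto simp: A_def)
      show ?thesis
      proof -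
        have "(p has_field_derivative of_nat N * inverse z ^ (N - 1) * - (inverse z)\<^sup>2) (at z)"
          unfolding p_def[abs_def] by (auto intro!: derivative_eq_intros simp: power2_eq_square)
        \<comment> \<open>For \<open>N = 0\<close> the truncated exponent \<open>N - 1\<close> is
          harmless because the factor \<open>of_nat N\<close> vanishes.\<close>
        then show ?thesis
          by (cases N) (simp_all add: p'_def power2_eq_square mult_ac)
      qed
    qed
    show "continuous_on A p'"
      unfolding p'_def[abs_def] by (auto intro!: continuous_intros simp: A_def)
  qed
  have W_A: "partials_on A W Wx Wy"
    by (rule partials_on_subset[OF W]) (auto simp: A_def)
  have W_deriv0: "Wx z = 0" "Wy z = 0" if "norm z < 1" for z
    using partials_zero[OF partials_onD(1)[OF W, of z], of "ball 0 1"] that W0 assms(5,6) by auto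
  note prod = partials_on_mult[OF partials_on_of_real[OF partials_on_subset[OF \<phi>(1)]] partials_on_mult[OF p W_A]]
  have 1: "partials_on A w wx wy"
  proof (rule partials_on_cong[OF prod])
    show "open A" by (auto simp: A_def)
    fix z assume z: "z \<in> A"
    show "of_real (\<phi> z) * (p z * W z) = w z"
      using z by (simp add: A_def w_def)
    show "of_real (\<phi> z) * (p z * Wx z + p' z * W z) + of_real (\<phi>x z) * (p z * W z) = wx z"
      using z W_deriv0[of z] W0[of z] by (auto simp: A_def wx_def)
    show "of_real (\<phi> z) * (p z * Wy z + \<i> * p' z * W z) + of_real (\<phi>y z) * (p z * W z) = wy z"
      using z W_deriv0[of z] W0[of z] by (auto simp: A_def wy_def)
  qed auto
  have w_out: "w z = 0" if "s \<le> norm z" for z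
    using \<phi>(2)[OF that] by (simp add: w_def)
  have wx_out: "wx z = 0 \<and> wy z = 0" if z: "s < norm z" for z
  proof (cases "norm z < \<rho>")
    case True
    have "z \<in> - cball 0 s" "z \<in> A" using z True assms(5) by (auto simp: A_def)
    then have "wx z = 0" "wy z = 0"
      using partials_zero[OF partials_onD(1)[OF 1], of z "- cball 0 s"] w_out by auto
    then show ?thesis by simp
  qed (auto simp: wx_def wy_def)
  have 2: "partials_on (- cball 0 s) w wx wy"
    by (rule partials_on_cong[OF partials_on_zero]) (use w_out wx_out in \<open>auto simp: open_Compl\<close>)
  have 3: "partials_on (ball 0 1) w wx wy"
    by (rule partials_on_cong[OF partials_on_zero]) (use W0 in \<open>auto simp: w_def wx_def wy_def\<close>)
  \<comment> \<open>The three open sets cover the plane: \<open>w\<close> vanishes on the unit disc,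
    which removes the pole of the weight, and outside radius \<open>s\<close>; the product rule
    applies on \<open>A\<close>.\<close>
  have "partials_on (ball 0 1 \<union> (A \<union> - cball 0 s)) w wx wy"
    by (intro partials_on_open_Un 1 2 3) (auto simp: A_def)
  also have "ball 0 1 \<union> (A \<union> - cball 0 s) = UNIV"
    using assms(5,6) by (auto simp: A_def)
  finally have 4: "partials_on UNIV w wx wy" .
  show ?thesis
  proof (intro exI conjI allI impI, rule 4)
    \<comment> \<open>The term with \<open>of_nat N\<close> comes from the derivative of the weight,
      \<open>p' z = - (of_nat N * inverse z * p z)\<close>.\<close>
    show "of_real (\<phi> z) * (inverse z ^ N * Wx z)
        = wx z + of_nat N * inverse z * w z - of_real (\<phi>x z) * (inverse z ^ N * W z)"
      if "1 \<le> norm z" "norm z < \<rho>" for z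
      using that by (simp add: wx_def w_def p_def p'_def algebra_simps)
  qed (use w_out in \<open>auto simp: w_def wx_def wy_def p_def algebra_simps\<close>)
qed


text \<open>The Cauchy-Riemann and Poincare estimates are applied to
  \<open>\<phi> z * inverse z ^ N * W i z\<close>. The Cauchy-Riemann term is bounded by
  \<open>k\<close> times weighted derivatives, which cost a factor N^2 and are absorbed by the
  assumption on \<open>k\<close>, plus cutoff terms. These live beyond radius \<open>r2\<close>,
  where the weight is at most \<open>inverse r2 ^ N\<close>; near \<open>z0\<close>, inside radius
  \<open>r1\<close>, it is at least \<open>inverse r1 ^ N\<close>.\<close>

lemma carleman_step:
  fixes W Wx Wy :: "'i \<Rightarrow> complex \<Rightarrow> complex"
  assumes "finite I"
    and W: "\<And>i. i \<in> I \<Longrightarrow> partials_on (ball 0 \<rho>) (W i) (Wx i) (Wy i)"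
    and W0: "\<And>i z. i \<in> I \<Longrightarrow> norm z < 1 \<Longrightarrow> W i z = 0"
    and M: "\<And>i z. i \<in> I \<Longrightarrow> norm z < \<rho> \<Longrightarrow> cmod (W i z) \<le> M"
    and dbar: "\<And>z. norm z < \<rho> \<Longrightarrow>
      (\<Sum>i\<in>I. (cmod (Wy i z - \<i> * Wx i z))\<^sup>2) \<le> k * (\<Sum>i\<in>I. (cmod (Wx i z))\<^sup>2)"
    and k: "0 \<le> k" "6 * k * (1 + 16 * (real N)\<^sup>2) \<le> 1 / 2"
    and r: "1 \<le> r1" "r1 \<le> r2" "r2 < s" "s < \<rho>" "\<rho> \<le> 2"
    and "j \<in> I" and c: "0 < c" "\<And>z. z \<in> ball z0 t \<Longrightarrow> norm z < r1 \<and> c \<le> cmod (W j z)"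
  shows "c\<^sup>2 * measure lborel (ball z0 t) * (inverse r1 ^ N)\<^sup>2
    \<le> 320 * (4 / (s - r2))\<^sup>2 * card I * M\<^sup>2 * (inverse r2 ^ N)\<^sup>2 * measure lborel (cball (0::complex) 2)"
proof -
  obtain \<phi> \<phi>x \<phi>y where \<phi>: "partials_on UNIV \<phi> \<phi>x \<phi>y"
    "\<And>z. norm z \<le> r2 \<Longrightarrow> \<phi> z = 1" "\<And>z. norm z \<ge> s \<Longrightarrow> \<phi> z = 0"
    "\<And>z. norm z \<le> r2 \<Longrightarrow> \<phi>x z = 0" "\<And>z. norm z \<le> r2 \<Longrightarrow> \<phi>y z = 0"
    "\<And>z. \<bar>\<phi>x z\<bar> \<le> 4 / (s - r2)" "\<And>z. \<bar>\<phi>y z\<bar> \<le> 4 / (s - r2)"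
    using radial_cutoff_exists[of r2 s] r by auto
  define G where "G = 4 / (s - r2)"
  have "G > 0" using r by (simp add: G_def)
  define p where "p z = inverse z ^ N" for z :: complex
  define Q where "Q i w wx wy \<longleftrightarrow> partials_on UNIV w wx wy \<and> (\<forall>z. norm z > s \<longrightarrow> w z = 0) \<and>
    (\<forall>z. norm z < \<rho> \<longrightarrow> w z = of_real (\<phi> z) * (p z * W i z)) \<and>
    (\<forall>z. norm z < 1 \<or> \<rho> \<le> norm z \<longrightarrow> wy z - \<i> * wx z = 0) \<and>
    (\<forall>z. 1 \<le> norm z \<longrightarrow> norm z < \<rho> \<longrightarrow>
      wy z - \<i> * wx z = of_real (\<phi> z) * (p z * (Wy i z - \<i> * Wx i z))
        + (of_real (\<phi>y z) - \<i> * of_real (\<phi>x z)) * (p z * W i z)) \<and>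
    (\<forall>z. 1 \<le> norm z \<longrightarrow> norm z < \<rho> \<longrightarrow>
      of_real (\<phi> z) * (p z * Wx i z)
        = wx z + of_nat N * inverse z * w z - of_real (\<phi>x z) * (p z * W i z))" for i w wx wy
  have "\<exists>w wx wy. Q i w wx wy" if "i \<in> I" for i
    unfolding Q_def p_def
    by (rule weighted_cutoff_partials[OF W[OF that] _ \<phi>(1)]) (use W0[OF that] r \<phi> in auto)
  then obtain w wx wy where Q: "\<And>i. i \<in> I \<Longrightarrow> Q i (w i) (wx i) (wy i)"
    by metis
  have w: "\<And>i. i \<in> I \<Longrightarrow> partials_on UNIV (w i) (wx i) (wy i)"
    and w_out: "\<And>i z. i \<in> I \<Longrightarrow> norm z > s \<Longrightarrow> w i z = 0"
    and w_eq: "\<And>i z. i \<in> I \<Longrightarrow> norm z < \<rho> \<Longrightarrow> w i z = of_real (\<phi> z) * (p z * W i z)"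
    and D_0: "\<And>i z. i \<in> I \<Longrightarrow> norm z < 1 \<or> \<rho> \<le> norm z \<Longrightarrow> wy i z - \<i> * wx i z = 0"
    and D_eq: "\<And>i z. i \<in> I \<Longrightarrow> 1 \<le> norm z \<Longrightarrow> norm z < \<rho> \<Longrightarrow>
      wy i z - \<i> * wx i z = of_real (\<phi> z) * (p z * (Wy i z - \<i> * Wx i z))
        + (of_real (\<phi>y z) - \<i> * of_real (\<phi>x z)) * (p z * W i z)"
    and wx_eq: "\<And>i z. i \<in> I \<Longrightarrow> 1 \<le> norm z \<Longrightarrow> norm z < \<rho> \<Longrightarrow>
      of_real (\<phi> z) * (p z * Wx i z)
        = wx i z + of_nat N * inverse z * w i z - of_real (\<phi>x z) * (p z * W i z)"
    using Q unfolding Q_def by blast+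
  define D where "D i z = wy i z - \<i> * wx i z" for i z
  \<comment> \<open>\<open>E\<close> collects the cutoff terms: 10 is 5/2 times 2^2, where
    \<open>2 * G\<close> bounds \<open>\<bar>\<phi>x z\<bar> + \<bar>\<phi>y z\<bar>\<close> and 5/2
    bounds \<open>6 * k + 2\<close>.\<close>
  define E where "E = 10 * G\<^sup>2 * card I * M\<^sup>2 * (inverse r2 ^ N)\<^sup>2"
  have "E \<ge> 0" by (simp add: E_def)
  \<comment> \<open>Only the sum over \<open>I\<close> is estimated, since \<open>dbar\<close>
    couples the components.\<close>
  have pointwise: "(\<Sum>i\<in>I. (cmod (D i z))\<^sup>2)
      \<le> 6 * k * ((\<Sum>i\<in>I. (cmod (wx i z))\<^sup>2) + (real N)\<^sup>2 * (\<Sum>i\<in>I. (cmod (w i z))\<^sup>2))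
        + indicator (cball 0 2) z * E" for z
  proof (cases "1 \<le> norm z \<and> norm z < \<rho>")
    case False
    then have "(\<Sum>i\<in>I. (cmod (D i z))\<^sup>2) = 0" using D_0 by (auto simp: D_def)
    then show ?thesis using k \<open>E \<ge> 0\<close> by (simp add: sum_nonneg)
  next
    case True
    define a where "a = (\<bar>\<phi>x z\<bar> + \<bar>\<phi>y z\<bar>) * cmod (p z) * M"
    have "cmod (of_real (\<phi>x z) * (p z * W i z)) \<le> a"
      "cmod ((of_real (\<phi>y z) - \<i> * of_real (\<phi>x z)) * (p z * W i z)) \<le> a" if "i \<in> I" for i
    proof -
      have "cmod (of_real (\<phi>y z) - \<i> * of_real (\<phi>x z)) \<le> \<bar>\<phi>x z\<bar> + \<bar>\<phi>y z\<bar>"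
        using norm_triangle_ineq4[of "of_real (\<phi>y z)" "\<i> * of_real (\<phi>x z)"] by (simp add: norm_mult)
      then show "cmod (of_real (\<phi>x z) * (p z * W i z)) \<le> a"
        "cmod ((of_real (\<phi>y z) - \<i> * of_real (\<phi>x z)) * (p z * W i z)) \<le> a"
        unfolding a_def norm_mult mult.assoc using True M[OF that, of z] by (auto intro!: mult_mono)
    qed
    note a = this
    \<comment> \<open>Up to radius \<open>r2\<close> the cutoff is constant and \<open>a\<close> is
      0; beyond it the weight is at most \<open>inverse r2 ^ N\<close>.\<close>
    have a_le: "a\<^sup>2 \<le> (2 * G * inverse r2 ^ N * M)\<^sup>2"
    proof (cases "norm z \<le> r2")
      case True
      then show ?thesis using \<phi>(4,5) by (simp add: a_def)
    next
      case False
      have "M \<ge> 0" using M[OF \<open>j \<in> I\<close>, of z] True norm_ge_zero order_trans by blast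
      have "inverse (cmod z) \<le> inverse r2" using False r by (intro le_imp_inverse_le) auto
      then have "cmod (p z) \<le> inverse r2 ^ N"
        by (simp add: p_def norm_power norm_inverse power_mono)
      moreover have "\<bar>\<phi>x z\<bar> + \<bar>\<phi>y z\<bar> \<le> 2 * G"
        using \<phi>(6,7)[of z] by (simp add: G_def)
      ultimately have "a \<le> 2 * G * inverse r2 ^ N * M"
        unfolding a_def using \<open>M \<ge> 0\<close> \<open>G > 0\<close> r by (intro mult_mono) auto
      moreover have "a \<ge> 0" using \<open>M \<ge> 0\<close> by (simp add: a_def)
      ultimately show ?thesis by (intro power_mono)
    qed
    define q where "q = (\<phi> z * cmod (p z))\<^sup>2"
    have D_le: "(cmod (D i z))\<^sup>2 \<le> 2 * (q * (cmod (Wy i z - \<i> * Wx i z))\<^sup>2) + 2 * a\<^sup>2" if "i \<in> I" for i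
    proof -
      have "cmod (D i z) \<le> \<bar>\<phi> z\<bar> * cmod (p z) * cmod (Wy i z - \<i> * Wx i z) + a"
        unfolding D_def using True a(2)[OF that]
        by (subst D_eq[OF that]) (auto intro!: norm_triangle_le simp: norm_mult)
      then have "(cmod (D i z))\<^sup>2 \<le> (\<bar>\<phi> z\<bar> * cmod (p z) * cmod (Wy i z - \<i> * Wx i z) + a)\<^sup>2"
        by (rule power_mono) simp
      also note sum_power2_le(1)
      finally show ?thesis by (simp add: power_mult_distrib q_def)
    qed
    have Wx_le: "q * (cmod (Wx i z))\<^sup>2 \<le> 3 * (cmod (wx i z))\<^sup>2 + 3 * ((real N)\<^sup>2 * (cmod (w i z))\<^sup>2) + 3 * a\<^sup>2"
      if "i \<in> I" for i
    proof -
      have "inverse (cmod z) \<le> 1" using True by (simp add: inverse_le_1_iff)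
      then have "cmod (of_nat N * inverse z * w i z) \<le> real N * 1 * cmod (w i z)"
        unfolding norm_mult norm_inverse norm_of_nat by (intro mult_mono) auto
      then have "cmod (of_real (\<phi> z) * (p z * Wx i z)) \<le> cmod (wx i z) + real N * cmod (w i z) + a"
        using wx_eq[OF that, of z] True a(1)[OF that]
          norm_triangle_ineq4[of "wx i z + of_nat N * inverse z * w i z" "of_real (\<phi>x z) * (p z * W i z)"]
          norm_triangle_ineq[of "wx i z" "of_nat N * inverse z * w i z"]
        by simp
      then have "(cmod (of_real (\<phi> z) * (p z * Wx i z)))\<^sup>2 \<le> (cmod (wx i z) + real N * cmod (w i z) + a)\<^sup>2"
        by (rule power_mono) simp
      also note sum_power2_le(2)
      finally show ?thesis by (simp add: power_mult_distrib q_def norm_mult mult.assoc)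
    qed
    have "(\<Sum>i\<in>I. (cmod (D i z))\<^sup>2) \<le> (\<Sum>i\<in>I. 2 * (q * (cmod (Wy i z - \<i> * Wx i z))\<^sup>2) + 2 * a\<^sup>2)"
      by (rule sum_mono) (rule D_le)
    also have "\<dots> = 2 * q * (\<Sum>i\<in>I. (cmod (Wy i z - \<i> * Wx i z))\<^sup>2) + 2 * card I * a\<^sup>2"
      by (simp add: sum.distrib sum_distrib_left mult.assoc)
    also have "\<dots> \<le> 2 * q * (k * (\<Sum>i\<in>I. (cmod (Wx i z))\<^sup>2)) + 2 * card I * a\<^sup>2"
      using dbar[of z] True by (intro add_right_mono mult_left_mono) (auto simp: q_def)
    also have "\<dots> = 2 * k * (\<Sum>i\<in>I. q * (cmod (Wx i z))\<^sup>2) + 2 * card I * a\<^sup>2"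
      by (simp add: sum_distrib_left mult_ac)
    also have "\<dots> \<le> 2 * k * (\<Sum>i\<in>I. 3 * (cmod (wx i z))\<^sup>2 + 3 * ((real N)\<^sup>2 * (cmod (w i z))\<^sup>2) + 3 * a\<^sup>2)
        + 2 * card I * a\<^sup>2"
      using k by (intro add_right_mono mult_left_mono sum_mono Wx_le) auto
    also have "\<dots> = 6 * k * ((\<Sum>i\<in>I. (cmod (wx i z))\<^sup>2) + (real N)\<^sup>2 * (\<Sum>i\<in>I. (cmod (w i z))\<^sup>2))
        + (6 * k + 2) * (card I * a\<^sup>2)"
      by (simp add: sum.distrib sum_distrib_left[symmetric] algebra_simps)
    also have "(6 * k + 2) * (card I * a\<^sup>2) \<le> (5 / 2) * (card I * (2 * G * inverse r2 ^ N * M)\<^sup>2)"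
    proof (intro mult_mono)
      have "6 * k * 1 \<le> 6 * k * (1 + 16 * (real N)\<^sup>2)" using k(1) by (intro mult_left_mono) auto
      then show "6 * k + 2 \<le> 5 / 2" using k(2) by linarith
    qed (use a_le k in auto)
    also have "\<dots> = indicator (cball 0 2) z * E"
      using True r by (simp add: E_def power_mult_distrib)
    finally show ?thesis by simp
  qed
  have w_out2: "w i z = 0" if "i \<in> I" "norm z > 2" for i z
    using w_out[OF that(1)] that(2) r by auto
  have int: "integrable lborel (\<lambda>z. (cmod (w i z))\<^sup>2)" "integrable lborel (\<lambda>z. (cmod (wx i z))\<^sup>2)"
    "integrable lborel (\<lambda>z. (cmod (D i z))\<^sup>2)" if "i \<in> I" for i
    unfolding D_def
    by (rule integrable_compact_support[where R = 2];
        use partials_onD(2-4)[OF w[OF that]] w_out2[OF that] partials_compact_support[OF w[OF that] w_out2[OF that]]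
        in \<open>auto intro!: continuous_intros\<close>)+
  define V where "V = measure lborel (cball (0::complex) 2)"
  have ind: "integrable lborel (\<lambda>z::complex. indicator (cball 0 2) z * E)"
    using borel_integrable_compact[OF compact_cball continuous_on_const, of "0::complex" 2 E]
    unfolding real_scaleR_def .
  define X where "X = (\<Sum>i\<in>I. \<integral>z. (cmod (wx i z))\<^sup>2 \<partial>lborel)"
  define Y where "Y = (\<Sum>i\<in>I. \<integral>z. (cmod (w i z))\<^sup>2 \<partial>lborel)"
  define A where "A = (\<Sum>i\<in>I. \<integral>z. (cmod (D i z))\<^sup>2 \<partial>lborel)"
  have "X \<le> A"
    unfolding X_def A_def D_def
    by (rule sum_mono) (rule integral_norm_partial_le_dbar[OF w w_out2])
  \<comment> \<open>The supports lie in the disc of radius 2, so the Poincare constant is 4 *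
    2^2.\<close>
  have "Y \<le> 16 * X"
    unfolding X_def Y_def sum_distrib_left
    using poincare_compact_support[OF w w_out2] by (intro sum_mono) fastforce
  have "A = (\<integral>z. (\<Sum>i\<in>I. (cmod (D i z))\<^sup>2) \<partial>lborel)"
    unfolding A_def using int by simp
  also have "\<dots> \<le> (\<integral>z. 6 * k * ((\<Sum>i\<in>I. (cmod (wx i z))\<^sup>2) + (real N)\<^sup>2 * (\<Sum>i\<in>I. (cmod (w i z))\<^sup>2))
        + indicator (cball 0 2) z * E \<partial>lborel)"
    using int ind pointwise by (intro integral_mono) auto
  also have "\<dots> = 6 * k * (X + (real N)\<^sup>2 * Y) + V * E"
    using int ind by (simp add: X_def Y_def V_def)
  also have "6 * k * (X + (real N)\<^sup>2 * Y) \<le> 6 * k * (A + (real N)\<^sup>2 * (16 * A))"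
    using \<open>X \<le> A\<close> \<open>Y \<le> 16 * X\<close> k by (intro mult_left_mono add_mono) auto
  also have "\<dots> = 6 * k * (1 + 16 * (real N)\<^sup>2) * A"
    by (simp add: algebra_simps)
  also have "\<dots> \<le> 1 / 2 * A"
    using k(2) by (rule mult_right_mono) (simp add: A_def sum_nonneg)
  \<comment> \<open>The chain reads \<open>A \<le> A / 2 + V * E\<close>, and half of
    \<open>A\<close> moves to the left.\<close>
  finally have "A \<le> 2 * (V * E)" by simp
  with \<open>X \<le> A\<close> \<open>Y \<le> 16 * X\<close> have "Y \<le> 32 * (V * E)" by simp
  have "c\<^sup>2 * measure lborel (ball z0 t) * (inverse r1 ^ N)\<^sup>2
      = (\<integral>z. indicator (ball z0 t) z * (c * inverse r1 ^ N)\<^sup>2 \<partial>lborel)"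
    by (simp add: power_mult_distrib mult_ac)
  also have "\<dots> \<le> (\<integral>z. (cmod (w j z))\<^sup>2 \<partial>lborel)"
  proof (rule integral_mono[OF _ int(1)[OF \<open>j \<in> I\<close>]])
    show "integrable lborel (\<lambda>z. indicator (ball z0 t) z * (c * inverse r1 ^ N)\<^sup>2)"
      using emeasure_lborel_ball_finite[of z0 t] by simp
    show "indicator (ball z0 t) z * (c * inverse r1 ^ N)\<^sup>2 \<le> (cmod (w j z))\<^sup>2" for z
    proof (cases "z \<in> ball z0 t")
      case True
      from c(2)[OF True] have z: "norm z < r1" "c \<le> cmod (W j z)" by auto
      \<comment> \<open>Where \<open>W j\<close> is nonzero, \<open>z\<close> lies outside the unit
        disc. This excludes 0, at which \<open>inverse\<close> takes its default value 0.\<close>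
      then have "1 \<le> norm z" using W0[OF \<open>j \<in> I\<close>, of z] c(1) by force
      then have "inverse r1 \<le> inverse (cmod z)" using z by (intro le_imp_inverse_le) auto
      then have "inverse r1 ^ N \<le> cmod (p z)"
        using r by (simp add: p_def norm_power norm_inverse power_mono)
      then have "c * inverse r1 ^ N \<le> cmod (W j z) * cmod (p z)"
        using z c(1) r by (intro mult_mono) auto
      also have "\<dots> = cmod (w j z)"
        using w_eq[OF \<open>j \<in> I\<close>, of z] \<phi>(2)[of z] z r by (simp add: norm_mult)
      finally show ?thesis using True c(1) r by (auto intro!: power_mono)
    qed auto
  qed
  also have "\<dots> \<le> Y"
    unfolding Y_def using \<open>finite I\<close> \<open>j \<in> I\<close> by (intro member_le_sum) auto
  also note \<open>Y \<le> 32 * (V * E)\<close>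
  finally show ?thesis by (simp add: E_def V_def G_def mult_ac)
qed

subsection \<open>Decay of small solutions\<close>

lemma content_ball_complex:
  "r \<ge> 0 \<Longrightarrow> measure lborel (ball (z::complex) r) = pi * r\<^sup>2"
  by (simp add: content_ball unit_ball_vol_2)

text \<open>\<open>N\<close> is the floor of \<open>1 / sqrt a\<close>; as this number is at least
  1, rounding down loses at most a factor 2.\<close>

lemma nat_of_order_inverse_sqrt:
  assumes "0 < a" "a \<le> 1"
  obtains N :: nat where "1 \<le> N" "a * (real N)\<^sup>2 \<le> 1" "1 \<le> 4 * a * (real N)\<^sup>2"
proof
  define x where "x = 1 / sqrt a"
  define N where "N = nat \<lfloor>x\<rfloor>"
  have x: "1 \<le> x" "a * x\<^sup>2 = 1"
    using assms by (auto simp: x_def power_divide)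
  then show N1: "1 \<le> N" by (simp add: N_def le_nat_floor)
  have N: "real N \<le> x" "x \<le> real N + 1" using x by (simp_all add: N_def)
  have "a * (real N)\<^sup>2 \<le> a * x\<^sup>2"
    using assms N by (intro mult_left_mono power_mono) auto
  then show "a * (real N)\<^sup>2 \<le> 1" using x by simp
  have "a * x\<^sup>2 \<le> a * (2 * real N)\<^sup>2"
    using assms N N1 x by (intro mult_left_mono power_mono) auto
  then show "1 \<le> 4 * a * (real N)\<^sup>2" using x by (simp add: power_mult_distrib)
qed

text \<open>Exponential decay is traded for polynomial decay of arbitrary order \<open>m\<close>,
  using 1 - t \<le> exp (- t) and x \<le> exp x at x = N t / m.\<close>

lemma one_minus_power_le:
  fixes t :: real
  assumes "0 < t" "t \<le> 1" "1 \<le> N"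
  shows "(1 - t) ^ N \<le> (m / (real N * t)) ^ m"
proof (cases "m = 0")
  case True
  then show ?thesis using assms by (simp add: power_le_one)
next
  case False
  have "(1 - t) ^ N \<le> exp (- t) ^ N"
    using assms exp_ge_add_one_self[of "- t"] by (intro power_mono) auto
  also have "\<dots> = inverse (exp (real N * t / m)) ^ m"
    using False by (simp add: exp_of_nat_mult[symmetric] exp_minus[symmetric])
  also have "\<dots> \<le> inverse (real N * t / m) ^ m"
  proof (intro power_mono le_imp_inverse_le)
    show "real N * t / m \<le> exp (real N * t / m)"
      using exp_ge_add_one_self[of "real N * t / m"] by linarith
  qed (use assms False in auto)
  finally show ?thesis by (simp add: inverse_eq_divide)
qed

text \<open>In \<open>sup_step\<close>, 64 comes from the fourth power of the value, 320 from
  \<open>carleman_step\<close>, 256 from the cutoff slope, 4 from the area of the disc of radius 2;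
  48 is 6 * 8 and 816 is 4 * 204. The summand 1 makes the constant at most its own fourth
  power.\<close>

definition sup_step_const :: "real \<Rightarrow> nat \<Rightarrow> real"
  where "sup_step_const K n = 1 + 64 * 320 * 256 * 4 * n * 48 ^ 12 * (816 * K) ^ 6"

text \<open>For \<open>m = cmod (W j z0)\<close>, the Lipschitz bound keeps |W j| above m/2 on a
  disc of radius m/4, so the left side of \<open>carleman_step\<close> is of order m^4. With
  \<open>N\<close> of order (K M)^(-1/2) the ratio of the weights gives m^4 \<le> const * M^8 /
  \<delta>^14. The gain is that \<open>M\<close> enters the final bound quadratically.\<close>

lemma sup_step:
  fixes W Wx Wy :: "'i \<Rightarrow> complex \<Rightarrow> complex"
  assumes "finite I" "0 < K"
    and W: "\<And>i. i \<in> I \<Longrightarrow> partials_on (ball 0 2) (W i) (Wx i) (Wy i)"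
    and W0: "\<And>i z. i \<in> I \<Longrightarrow> norm z < 1 \<Longrightarrow> W i z = 0"
    and B: "\<And>i z. i \<in> I \<Longrightarrow> norm z < 2 \<Longrightarrow> cmod (Wx i z) \<le> 1"
      "\<And>i z. i \<in> I \<Longrightarrow> norm z < 2 \<Longrightarrow> cmod (Wy i z) \<le> 1"
    and dbar: "\<And>M z. norm z < 2 \<Longrightarrow> (\<And>i. i \<in> I \<Longrightarrow> cmod (W i z) \<le> M) \<Longrightarrow>
      (\<Sum>i\<in>I. (cmod (Wy i z - \<i> * Wx i z))\<^sup>2) \<le> K * M * (\<Sum>i\<in>I. (cmod (Wx i z))\<^sup>2)"
    and \<delta>: "0 < \<delta>" "1 \<le> \<rho>" "\<rho> + \<delta> \<le> 2"
    and M: "\<And>i z. i \<in> I \<Longrightarrow> norm z < \<rho> + \<delta> \<Longrightarrow> cmod (W i z) \<le> M" "M \<le> \<delta>" "204 * K * M \<le> 1"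
    and "j \<in> I" and z0: "norm z0 < \<rho>"
  shows "cmod (W j z0) \<le> sup_step_const K (card I) * M\<^sup>2 / \<delta> ^ 4"
proof (cases "W j z0 = 0")
  case True
  then show ?thesis using \<open>0 < K\<close> by (simp add: sup_step_const_def)
next
  case False
  define m where "m = cmod (W j z0)"
  have m: "0 < m" "m \<le> M" using False M(1)[OF \<open>j \<in> I\<close>, of z0] \<delta> z0 by (auto simp: m_def)
  then have "M > 0" by simp
  define r1 r2 s where "r1 = \<rho> + \<delta> / 4" and "r2 = \<rho> + \<delta> / 2" and "s = \<rho> + 3 * \<delta> / 4"
  have r: "1 \<le> r1" "r1 \<le> r2" "r2 < s" "s < \<rho> + \<delta>" "s - r2 = \<delta> / 4" "0 < r1" "0 < r2"
    using \<delta> by (simp_all add: r1_def r2_def s_def)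
  \<comment> \<open>204 is 12 * 17: since 1 + 16 N^2 \<le> 17 N^2, the absorption condition of
    \<open>carleman_step\<close> follows.\<close>
  obtain N where N: "1 \<le> N" "204 * K * M * (real N)\<^sup>2 \<le> 1" "1 \<le> 4 * (204 * K * M) * (real N)\<^sup>2"
    using nat_of_order_inverse_sqrt[of "204 * K * M"] M(3) \<open>0 < K\<close> \<open>M > 0\<close> by auto
  have "1 \<le> (real N)\<^sup>2" using N(1) by (simp add: one_le_power)
  then have "12 * K * M * (1 + 16 * (real N)\<^sup>2) \<le> 12 * K * M * (17 * (real N)\<^sup>2)"
    using \<open>0 < K\<close> \<open>M > 0\<close> by (intro mult_left_mono) auto
  with N(2) have k: "6 * (K * M) * (1 + 16 * (real N)\<^sup>2) \<le> 1 / 2" by simp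
  \<comment> \<open>Partials bounded by 1 give the Lipschitz constant 2, so |W j| drops by at most
    m/2; \<open>m \<le> M \<le> \<delta>\<close> keeps the disc inside radius
    \<open>r1\<close>.\<close>
  have near: "norm z < r1 \<and> m / 2 \<le> cmod (W j z)" if "z \<in> ball z0 (m / 4)" for z
  proof
    have "norm (z - z0) < m / 4" using that by (simp add: dist_norm norm_minus_commute)
    then have "norm z < \<rho> + m / 4" using norm_triangle_sub[of z z0] z0 by simp
    then show "norm z < r1" using m M(2) by (simp add: r1_def)
    then have "norm (W j z - W j z0) \<le> 2 * 1 * norm (z - z0)"
      using r \<delta> B \<open>j \<in> I\<close> z0 by (intro partials_on_norm_le[OF W]) auto
    then show "m / 2 \<le> cmod (W j z)"
      using \<open>norm (z - z0) < m / 4\<close> norm_triangle_ineq2[of "W j z0" "W j z"]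
      by (simp add: m_def norm_minus_commute)
  qed
  have "(m / 2)\<^sup>2 * measure lborel (ball z0 (m / 4)) * (inverse r1 ^ N)\<^sup>2
    \<le> 320 * (4 / (s - r2))\<^sup>2 * card I * M\<^sup>2 * (inverse r2 ^ N)\<^sup>2 * measure lborel (cball (0::complex) 2)"
  proof (rule carleman_step[where \<rho> = "\<rho> + \<delta>" and k = "K * M" and W = W and Wx = Wx and Wy = Wy])
    show "partials_on (ball 0 (\<rho> + \<delta>)) (W i) (Wx i) (Wy i)" if "i \<in> I" for i
      using W[OF that] by (rule partials_on_subset) (use \<delta> in auto)
    show "cmod (W i z) \<le> M" if "i \<in> I" "norm z < \<rho> + \<delta>" for i z
      using M(1)[OF that] .
    show "(\<Sum>i\<in>I. (cmod (Wy i z - \<i> * Wx i z))\<^sup>2) \<le> K * M * (\<Sum>i\<in>I. (cmod (Wx i z))\<^sup>2)"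
      if "norm z < \<rho> + \<delta>" for z
      using dbar[of z M] M(1) that \<delta>(3) by simp
    show "norm z < r1 \<and> m / 2 \<le> cmod (W j z)" if "z \<in> ball z0 (m / 4)" for z
      using near[OF that] .
  qed (use \<open>finite I\<close> W0 \<open>j \<in> I\<close> \<open>0 < K\<close> \<open>M > 0\<close> k r m(1) \<delta>(3) in simp_all)
  also have "measure lborel (cball (0::complex) 2) = 4 * pi"
    unfolding content_cball_conv_ball by (subst content_ball_complex) auto
  also have "measure lborel (ball z0 (m / 4)) = pi * (m / 4)\<^sup>2"
    using m by (intro content_ball_complex) auto
  also have "(m / 2)\<^sup>2 * (pi * (m / 4)\<^sup>2) * (inverse r1 ^ N)\<^sup>2 = pi / 64 * (m ^ 4 * (inverse r1 ^ N)\<^sup>2)"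
    by (simp add: power2_eq_square power4_eq_xxxx)
  also have "320 * (4 / (s - r2))\<^sup>2 * card I * M\<^sup>2 * (inverse r2 ^ N)\<^sup>2 * (4 * pi)
      = pi / 64 * (64 * 320 * 256 * 4 * card I * M\<^sup>2 / \<delta>\<^sup>2 * (inverse r2 ^ N)\<^sup>2)"
    unfolding r(5) by (simp add: power_divide)
  finally have "m ^ 4 * (inverse r1 ^ N)\<^sup>2 \<le> 64 * 320 * 256 * 4 * card I * M\<^sup>2 / \<delta>\<^sup>2 * (inverse r2 ^ N)\<^sup>2"
    by (rule mult_left_le_imp_le) simp
  then have "(m ^ 4 * (inverse r1 ^ N)\<^sup>2) * (r1 ^ N)\<^sup>2
      \<le> (64 * 320 * 256 * 4 * card I * M\<^sup>2 / \<delta>\<^sup>2 * (inverse r2 ^ N)\<^sup>2) * (r1 ^ N)\<^sup>2"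
    by (rule mult_right_mono) simp
  then have "m ^ 4 \<le> 64 * 320 * 256 * 4 * card I * M\<^sup>2 / \<delta>\<^sup>2 * ((r1 / r2) ^ N)\<^sup>2"
    using r by (simp add: power_divide field_simps)
  also have "\<dots> \<le> 64 * 320 * 256 * 4 * card I * M\<^sup>2 / \<delta>\<^sup>2 * ((48 ^ 12 * (816 * K * M) ^ 6) / \<delta> ^ 12)"
  proof (rule mult_left_mono)
    have "r1 / r2 \<le> 1 - \<delta> / 8"
    proof -
      have "\<delta> * r2 \<le> \<delta> * 2" using \<delta> by (intro mult_left_mono) (auto simp: r2_def)
      moreover have "r1 = r2 - \<delta> / 4" by (simp add: r1_def r2_def)
      ultimately have "r1 \<le> (1 - \<delta> / 8) * r2" by (simp add: algebra_simps)
      then show ?thesis using r(7) by (simp add: pos_divide_le_eq)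
    qed
    then have "((r1 / r2) ^ N)\<^sup>2 \<le> ((1 - \<delta> / 8) ^ N)\<^sup>2"
      using r by (intro power_mono) auto
    \<comment> \<open>Order 6 yields N^(-12), hence M^6; together with the factor M^2 this is the
      fourth power of M^2.\<close>
    also have "\<dots> \<le> ((6 / (real N * (\<delta> / 8))) ^ 6)\<^sup>2"
      using one_minus_power_le[of "\<delta> / 8" N 6] \<delta> N(1) by (intro power_mono) auto
    also have "\<dots> = (48 ^ 12) * (1 / (real N)\<^sup>2) ^ 6 / \<delta> ^ 12"
      using \<delta> N(1) by (simp add: power_divide power_mult_distrib power_mult[symmetric])
    also have "\<dots> \<le> (48 ^ 12) * (816 * K * M) ^ 6 / \<delta> ^ 12"
      using \<delta> N \<open>0 < K\<close> \<open>M > 0\<close>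
      by (intro divide_right_mono mult_mono power_mono) (auto simp: divide_le_eq)
    finally show "((r1 / r2) ^ N)\<^sup>2 \<le> (48 ^ 12 * (816 * K * M) ^ 6) / \<delta> ^ 12" .
  qed auto
  also have "\<dots> = (sup_step_const K (card I) - 1) * (M\<^sup>2) ^ 4 / \<delta> ^ 14"
    by (simp add: sup_step_const_def power_mult_distrib power_mult[symmetric] power_add[symmetric] mult_ac)
  \<comment> \<open>As \<delta> \<le> 1, weakening \<delta>^14 to \<delta>^16 turns the bound into a
    fourth power, so that fourth roots can be taken.\<close>
  also have "\<dots> \<le> sup_step_const K (card I) ^ 4 * (M\<^sup>2) ^ 4 / \<delta> ^ 16"
  proof (intro frac_le mult_right_mono)
    have "1 \<le> sup_step_const K (card I)" using \<open>0 < K\<close> by (simp add: sup_step_const_def)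
    then have "sup_step_const K (card I) ^ 1 \<le> sup_step_const K (card I) ^ 4"
      by (intro power_increasing) auto
    then show "sup_step_const K (card I) - 1 \<le> sup_step_const K (card I) ^ 4" by simp
    show "\<delta> ^ 16 \<le> \<delta> ^ 14" using \<delta> by (intro power_decreasing) auto
  qed (use \<delta> in auto)
  also have "\<dots> = (sup_step_const K (card I) * M\<^sup>2 / \<delta> ^ 4) ^ 4"
    by (simp add: power_divide power_mult_distrib power_mult[symmetric])
  finally have "m ^ 4 \<le> (sup_step_const K (card I) * M\<^sup>2 / \<delta> ^ 4) ^ 4" .
  then show ?thesis
    unfolding m_def using \<open>0 < K\<close> by (subst (asm) power_mono_iff) (simp_all add: sup_step_const_def)
qed

text \<open>\<open>sup_step\<close> is iterated on discs whose radii decrease to 3/2. The quadratic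
  gain in the supremum outweighs the loss \<delta>^(-4) caused by halving the gaps, so the suprema
  tend to 0 geometrically.\<close>

lemma small_solution_vanishes:
  fixes W Wx Wy :: "'i \<Rightarrow> complex \<Rightarrow> complex"
  assumes "finite I" "0 < K"
    and W: "\<And>i. i \<in> I \<Longrightarrow> partials_on (ball 0 2) (W i) (Wx i) (Wy i)"
    and W0: "\<And>i z. i \<in> I \<Longrightarrow> norm z < 1 \<Longrightarrow> W i z = 0"
    and B: "\<And>i z. i \<in> I \<Longrightarrow> norm z < 2 \<Longrightarrow> cmod (Wx i z) \<le> 1"
      "\<And>i z. i \<in> I \<Longrightarrow> norm z < 2 \<Longrightarrow> cmod (Wy i z) \<le> 1"
    and dbar: "\<And>M z. norm z < 2 \<Longrightarrow> (\<And>i. i \<in> I \<Longrightarrow> cmod (W i z) \<le> M) \<Longrightarrow>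
      (\<Sum>i\<in>I. (cmod (Wy i z - \<i> * Wx i z))\<^sup>2) \<le> K * M * (\<Sum>i\<in>I. (cmod (Wx i z))\<^sup>2)"
    and \<epsilon>: "\<And>i z. i \<in> I \<Longrightarrow> norm z < 2 \<Longrightarrow> cmod (W i z) \<le> \<epsilon>"
      "\<epsilon> \<le> 1 / 4" "204 * K * \<epsilon> \<le> 1" "4096 * sup_step_const K (card I) * \<epsilon> \<le> 1"
    and "j \<in> I" and z: "norm z < 3 / 2"
  shows "W j z = 0"
proof -
  have "0 \<le> \<epsilon>" using order_trans[OF norm_ge_zero \<epsilon>(1)[OF \<open>j \<in> I\<close>, of 0]] by simp
  define C where "C = sup_step_const K (card I)"
  have bound: "\<forall>i\<in>I. \<forall>z. norm z < 3 / 2 + 1 / 2 ^ Suc n \<longrightarrow> cmod (W i z) \<le> \<epsilon> / 16 ^ n" for n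
  proof (induction n)
    case 0
    then show ?case using \<epsilon>(1) by simp
  next
    case (Suc n)
    show ?case
    proof (intro ballI allI impI)
      fix i and z :: complex
      assume i: "i \<in> I" and z: "norm z < 3 / 2 + 1 / 2 ^ Suc (Suc n)"
      \<comment> \<open>This is the gap between consecutive radii. As \<delta>^(-4) = 256 * 16^n,
        squaring \<open>\<epsilon> / 16 ^ n\<close> leaves a factor 256, and passing to
        \<open>16 ^ Suc n\<close> makes it 4096.\<close>
      define \<delta> :: real where "\<delta> = 1 / 2 ^ Suc (Suc n)"
      have p: "(1::real) \<le> 2 ^ n" by simp
      have "cmod (W i z) \<le> sup_step_const K (card I) * (\<epsilon> / 16 ^ n)\<^sup>2 / \<delta> ^ 4"
      proof (rule sup_step[OF assms(1,2) W W0 B dbar, where \<rho> = "3 / 2 + 1 / 2 ^ Suc (Suc n)"])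
        show "1 \<le> 3 / 2 + (1::real) / 2 ^ Suc (Suc n)" by (rule order_trans[of _ "3 / 2"]) auto
        show "3 / 2 + 1 / 2 ^ Suc (Suc n) + \<delta> \<le> 2"
          using p by (simp add: \<delta>_def divide_simps)
        show "cmod (W i z) \<le> \<epsilon> / 16 ^ n"
          if "i \<in> I" "cmod z < 3 / 2 + 1 / 2 ^ Suc (Suc n) + \<delta>" for i z
          using that Suc.IH by (simp add: \<delta>_def)
        have "\<epsilon> / 16 ^ n \<le> (1 / 4) / 2 ^ n"
          using \<epsilon>(2) \<open>0 \<le> \<epsilon>\<close> by (intro frac_le power_mono) auto
        then show "\<epsilon> / 16 ^ n \<le> \<delta>" by (simp add: \<delta>_def)
        have "\<epsilon> / 16 ^ n \<le> \<epsilon> / 1" using \<open>0 \<le> \<epsilon>\<close> by (intro divide_left_mono) auto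
        then have "204 * K * (\<epsilon> / 16 ^ n) \<le> 204 * K * \<epsilon>" using \<open>0 < K\<close> by (intro mult_left_mono) auto
        then show "204 * K * (\<epsilon> / 16 ^ n) \<le> 1" using \<epsilon>(3) by (rule order_trans)
      qed (use i z in \<open>auto simp: \<delta>_def\<close>)
      also have "\<dots> = (4096 * C * \<epsilon>) * (\<epsilon> / 16 ^ Suc n)"
      proof -
        have "\<delta> ^ 4 = 1 / (256 * 16 ^ n)"
          by (simp add: \<delta>_def power_divide power_mult_distrib flip: power_mult)
            (simp add: power_mult mult.commute[of n])
        then show ?thesis by (simp add: C_def power2_eq_square)
      qed
      also have "\<dots> \<le> 1 * (\<epsilon> / 16 ^ Suc n)"
        using \<epsilon>(4) \<open>0 \<le> \<epsilon>\<close> by (intro mult_right_mono) (auto simp: C_def)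
      finally show "cmod (W i z) \<le> \<epsilon> / 16 ^ Suc n" by simp
    qed
  qed
  have "cmod (W j z) \<le> \<epsilon> / 16 ^ n" for n
  proof -
    have "norm z < 3 / 2 + 1 / 2 ^ Suc n" using z by (rule less_le_trans) simp
    then show ?thesis using bound[of n] \<open>j \<in> I\<close> by blast
  qed
  moreover have "(\<lambda>n. \<epsilon> * (1 / 16) ^ n) \<longlonglongrightarrow> \<epsilon> * 0"
    by (intro tendsto_mult_left LIMSEQ_realpow_zero) auto
  ultimately have "cmod (W j z) \<le> 0"
    by (intro LIMSEQ_le_const[where X = "\<lambda>n. \<epsilon> * (1 / 16) ^ n"]) (auto simp: power_divide)
  then show ?thesis by simp
qed

text \<open>Dividing by \<open>R\<close> as well leaves the size of the first derivatives unchanged,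
  so their smallness survives the rescaling.\<close>

lemma partials_on_rescale:
  assumes f: "partials_on (ball c (R * r)) f fx fy" and "R > 0"
  shows "partials_on (ball 0 r) (\<lambda>z. f (c + R *\<^sub>R z) /\<^sub>R R)
    (\<lambda>z. fx (c + R *\<^sub>R z)) (\<lambda>z. fy (c + R *\<^sub>R z))"
proof -
  have in_ball: "c + R *\<^sub>R z \<in> ball c (R * r)" if "z \<in> ball 0 r" for z :: complex
    using that \<open>R > 0\<close> by (simp add: dist_norm)
  have "((\<lambda>z. f (c + R *\<^sub>R z) /\<^sub>R R) has_derivative
      (\<lambda>h. Re h *\<^sub>R fx (c + R *\<^sub>R z) + Im h *\<^sub>R fy (c + R *\<^sub>R z))) (at z)"
    if "z \<in> ball 0 r" for z
  proof -
    have "((\<lambda>z. c + R *\<^sub>R z) has_derivative (\<lambda>h. R *\<^sub>R h)) (at z)"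
      by (auto intro!: derivative_eq_intros)
    from has_derivative_compose[OF this partials_onD(1)[OF f in_ball[OF that]]]
    have "((\<lambda>z. f (c + R *\<^sub>R z) /\<^sub>R R) has_derivative
      (\<lambda>h. (Re (R *\<^sub>R h) *\<^sub>R fx (c + R *\<^sub>R z) + Im (R *\<^sub>R h) *\<^sub>R fy (c + R *\<^sub>R z)) /\<^sub>R R)) (at z)"
      by (rule has_derivative_scaleR_right)
    then show ?thesis
      using \<open>R > 0\<close> by (simp add: scaleR_add_right flip: mult.assoc)
  qed
  moreover have "continuous_on (ball 0 r) (\<lambda>z. g (c + R *\<^sub>R z))"
    if "continuous_on (ball c (R * r)) g" for g :: "complex \<Rightarrow> 'a"
    using in_ball by (intro continuous_on_compose2[OF that]) (auto intro!: continuous_intros)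
  ultimately show ?thesis
    using partials_onD(2,3)[OF f] by (simp add: partials_on_def)
qed

lemma partials_on_bounded_linear:
  assumes "bounded_linear l" and f: "partials_on S f fx fy"
  shows "partials_on S (\<lambda>z. l (f z)) (\<lambda>z. l (fx z)) (\<lambda>z. l (fy z))"
proof -
  interpret l: bounded_linear l by fact
  show ?thesis
    using partials_onD[OF f] l.has_derivative[of f _ "at _"] l.continuous_on
    by (fastforce simp: partials_on_def l.add l.scaleR)
qed

text \<open>After rescaling to the unit disc, \<open>W\<close> vanishes at 0 and has partials at
  most \<open>\<eta>\<close>, hence |W| \<le> 4 \<eta>; the constants 16, 816 and 16384 are four
  times those of \<open>small_solution_vanishes\<close>. The differential inequality persists
  because \<open>R \<le> 1\<close> gives |V| = R |W| \<le> |W|.\<close>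

lemma vanishes_on_larger_disc:
  fixes V Vx Vy :: "'i \<Rightarrow> complex \<Rightarrow> complex"
  assumes "finite I" "0 < K"
    and V: "\<And>i. i \<in> I \<Longrightarrow> partials_on (ball c (2 * R)) (V i) (Vx i) (Vy i)"
    and V0: "\<And>i z. i \<in> I \<Longrightarrow> z \<in> ball c R \<Longrightarrow> V i z = 0"
    and R: "0 < R" "R \<le> 1"
    and B: "\<And>i z. i \<in> I \<Longrightarrow> z \<in> ball c (2 * R) \<Longrightarrow> cmod (Vx i z) \<le> \<eta>"
      "\<And>i z. i \<in> I \<Longrightarrow> z \<in> ball c (2 * R) \<Longrightarrow> cmod (Vy i z) \<le> \<eta>"
    and \<eta>: "16 * \<eta> \<le> 1" "816 * K * \<eta> \<le> 1" "16384 * sup_step_const K (card I) * \<eta> \<le> 1"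
    and dbar: "\<And>M z. z \<in> ball c (2 * R) \<Longrightarrow> (\<And>i. i \<in> I \<Longrightarrow> cmod (V i z) \<le> M) \<Longrightarrow>
      (\<Sum>i\<in>I. (cmod (Vy i z - \<i> * Vx i z))\<^sup>2) \<le> K * M * (\<Sum>i\<in>I. (cmod (Vx i z))\<^sup>2)"
    and "j \<in> I" and z: "z \<in> ball c (3 / 2 * R)"
  shows "V j z = 0"
proof -
  define W where "W i z = V i (c + R *\<^sub>R z) /\<^sub>R R" for i z
  define Wx where "Wx i z = Vx i (c + R *\<^sub>R z)" for i z
  define Wy where "Wy i z = Vy i (c + R *\<^sub>R z)" for i z
  have W: "partials_on (ball 0 2) (W i) (Wx i) (Wy i)" if "i \<in> I" for i
    unfolding W_def[abs_def] Wx_def[abs_def] Wy_def[abs_def]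
    using V[OF that] R by (intro partials_on_rescale) (simp_all add: mult.commute)
  have in_ball: "c + R *\<^sub>R z \<in> ball c (R * r) \<longleftrightarrow> norm z < r" for z r
    using R by (simp add: dist_norm)
  have in2: "c + R *\<^sub>R z \<in> ball c (2 * R)" if "norm z < 2" for z
    using in_ball[of z 2] that by (simp add: mult.commute)
  have W0: "W i z = 0" if "i \<in> I" "norm z < 1" for i z
    using V0[OF that(1)] in_ball[of z 1] that(2) by (simp add: W_def)
  have "cmod (V j c) \<le> 4 * \<eta>" "0 \<le> \<eta>"
    using V0[OF \<open>j \<in> I\<close>, of c] R B(1)[OF \<open>j \<in> I\<close>, of c] order_trans[OF norm_ge_zero] by auto
  have "W j ((z - c) /\<^sub>R R) = 0"
  proof (rule small_solution_vanishes[OF assms(1,2) W W0, where \<epsilon> = "4 * \<eta>"])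
    show 1: "cmod (Wx i z) \<le> 1" "cmod (Wy i z) \<le> 1" if "i \<in> I" "norm z < 2" for i z
      using B[OF that(1) in2[OF that(2)]] \<eta>(1) \<open>0 \<le> \<eta>\<close> by (simp_all add: Wx_def Wy_def)
    show "cmod (W i z) \<le> 4 * \<eta>" if "i \<in> I" "norm z < 2" for i z
    proof -
      have "norm (W i z - W i 0) \<le> 2 * \<eta> * norm (z - 0)"
        using B[OF that(1) in2] that(2)
        by (intro partials_on_norm_le[OF W[OF that(1)]]) (auto simp: Wx_def Wy_def)
      also have "\<dots> \<le> 2 * \<eta> * 2"
        using that \<open>0 \<le> \<eta>\<close> by (intro mult_left_mono) auto
      finally show ?thesis using W0[OF that(1), of 0] by simp
    qed
    show "(\<Sum>i\<in>I. (cmod (Wy i z - \<i> * Wx i z))\<^sup>2) \<le> K * M * (\<Sum>i\<in>I. (cmod (Wx i z))\<^sup>2)"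
      if "norm z < 2" "\<And>i. i \<in> I \<Longrightarrow> cmod (W i z) \<le> M" for M z
      unfolding Wx_def Wy_def
    proof (rule dbar[OF in2[OF that(1)]])
      show "cmod (V i (c + R *\<^sub>R z)) \<le> M" if "i \<in> I" for i
      proof -
        have "cmod (V i (c + R *\<^sub>R z)) = R * cmod (W i z)"
          using R by (simp add: W_def)
        also have "\<dots> \<le> 1 * cmod (W i z)"
          using R by (intro mult_right_mono) auto
        finally show ?thesis using \<open>\<And>i. i \<in> I \<Longrightarrow> cmod (W i z) \<le> M\<close>[OF that] by simp
      qed
    qed
    show "norm ((z - c) /\<^sub>R R) < 3 / 2"
      using z R by (simp add: dist_norm norm_minus_commute[of c] inverse_eq_divide pos_divide_less_eq)
  qed (use \<eta> \<open>j \<in> I\<close> in auto)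
  then show ?thesis using R by (simp add: W_def)
qed

subsection \<open>The zero set of a pseudoholomorphic map\<close>

text \<open>These coordinates turn the constant complex structure \<open>J\<close> into multiplication by \<open>\<i>\<close>.\<close>

definition complex_coord :: "('a::euclidean_space \<Rightarrow>\<^sub>L 'a) \<Rightarrow> 'a \<Rightarrow> 'a \<Rightarrow> complex"
  where "complex_coord J b v = Complex (v \<bullet> b) (- (J v \<bullet> b))"

lemma bounded_linear_complex_coord: "bounded_linear (complex_coord J b)"
proof -
  have "complex_coord J b = (\<lambda>v. of_real (v \<bullet> b) - \<i> * of_real (J v \<bullet> b))"
    by (simp add: complex_coord_def fun_eq_iff complex_eq_iff)
  moreover have 1: "bounded_linear (\<lambda>v. complex_of_real (v \<bullet> b))"
    by (rule bounded_linear_compose[OF bounded_linear_of_real bounded_linear_inner_left])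
  moreover have "bounded_linear (\<lambda>v. complex_of_real (J v \<bullet> b))"
    by (rule bounded_linear_compose[OF 1 blinfun.bounded_linear_right])
  ultimately show ?thesis
    by (simp add: bounded_linear_sub bounded_linear_const_mult)
qed

text \<open>This identity dictates the minus sign in the imaginary part of
  \<open>complex_coord\<close>.\<close>

lemma complex_coord_J:
  fixes J :: "'a::euclidean_space \<Rightarrow>\<^sub>L 'a"
  assumes "J (J v) = - v"
  shows "complex_coord J b (J v) = \<i> * complex_coord J b v"
  using assms by (simp add: complex_coord_def complex_eq_iff)

text \<open>One complex coordinate is taken for every real basis vector. The family is redundant,
  but no complex basis has to be chosen, and Parseval compares it with the norm.\<close>

lemma sum_cmod_complex_coord:
  fixes J :: "'a::euclidean_space \<Rightarrow>\<^sub>L 'a"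
  shows "(\<Sum>b\<in>Basis. (cmod (complex_coord J b v))\<^sup>2) = (norm v)\<^sup>2 + (norm (J v))\<^sup>2"
proof -
  have "(norm w)\<^sup>2 = (\<Sum>b\<in>Basis. (w \<bullet> b)\<^sup>2)" for w :: 'a
    unfolding power2_norm_eq_inner by (subst euclidean_inner) (simp add: power2_eq_square)
  then show ?thesis by (simp add: complex_coord_def cmod_power2 sum.distrib)
qed

lemma continuous_zero_closure:
  fixes f :: "'a::topological_space \<Rightarrow> 'b::{t1_space, zero}"
  assumes "continuous_on S f" "open S" "p \<in> S" "p \<in> closure Z" "\<And>z. z \<in> Z \<Longrightarrow> f z = 0"
  shows "f p = 0"
proof (rule ccontr)
  assume "f p \<noteq> 0"
  have "open (S \<inter> f -` (- {0}))"
    using assms(1,2) by (intro continuous_open_preimage) auto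
  moreover have "(S \<inter> f -` (- {0})) \<inter> Z = {}" using assms(5) by auto
  ultimately have "(S \<inter> f -` (- {0})) \<inter> closure Z = {}"
    by (simp add: open_Int_closure_eq_empty)
  then show False using assms(3,4) \<open>f p \<noteq> 0\<close> by auto
qed


text \<open>Near a limit point \<open>p\<close> outside \<open>Z\<close>, a maximal disc of zeros
  around some \<open>q\<close> in \<open>Z\<close> has a point \<open>x\<close> outside
  \<open>Z\<close> on its boundary. All first derivatives are small there, so
  \<open>vanishes_on_larger_disc\<close> enlarges the disc past \<open>x\<close>, a
  contradiction.\<close>

lemma interior_zeros_relatively_closed:
  fixes J :: "'a::euclidean_space \<Rightarrow> 'a \<Rightarrow>\<^sub>L 'a" and u :: "complex \<Rightarrow> 'a"
  assumes J: "\<And>q v. J q (J q v) = - v"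
    and holder: "locally_holder_on (1 / 2) UNIV J"
    and u: "partials_on S u ux uy" and "open S"
    and Ju: "\<And>z. z \<in> S \<Longrightarrow> uy z = J (u z) (ux z)"
    and Z: "Z = interior {z \<in> S. u z = 0}" and p: "p \<in> S" "p \<in> closure Z"
  shows "p \<in> Z"
proof (rule ccontr)
  assume "p \<notin> Z"
  have "open Z" by (simp add: Z)
  have Z_u: "z \<in> S \<and> u z = 0" if "z \<in> Z" for z
    using that interior_subset unfolding Z by blast
  note cont = partials_onD(2-4)[OF u]
  have "u p = 0"
    by (rule continuous_zero_closure[OF cont(3) \<open>open S\<close> p]) (simp add: Z_u)
  \<comment> \<open>The partials vanish on the open set \<open>Z\<close>, hence by continuity at
    \<open>p\<close>; this is the source of smallness.\<close>
  have ux_Z: "ux z = 0 \<and> uy z = 0" if "z \<in> Z" for z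
    using partials_zero[OF partials_onD(1)[OF u] \<open>open Z\<close> that] Z_u that by blast
  have "ux p = 0" "uy p = 0"
    by (rule continuous_zero_closure[OF cont(1) \<open>open S\<close> p], simp add: ux_Z)
       (rule continuous_zero_closure[OF cont(2) \<open>open S\<close> p], simp add: ux_Z)
  obtain U C0 where U: "open U" "0 \<in> U"
    and C0: "\<And>x y. x \<in> U \<Longrightarrow> y \<in> U \<Longrightarrow> dist (J x) (J y) \<le> C0 * dist x y powr (1 / 2)"
    using bspec[OF holder[unfolded locally_holder_on_def] UNIV_I, of 0] by (elim exE conjE) auto
  define C where "C = max C0 1"
  have C: "norm (J x - J 0) \<le> C * norm x powr (1 / 2)" if "x \<in> U" for x
  proof -
    have "norm (J x - J 0) \<le> C0 * norm x powr (1 / 2)"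
      using C0[OF that U(2)] by (simp add: dist_norm)
    also have "\<dots> \<le> C * norm x powr (1 / 2)"
      by (intro mult_right_mono) (auto simp: C_def)
    finally show ?thesis .
  qed
  define B where "B = norm (J 0)"
  have B: "B \<ge> 0" "\<And>v. norm (J 0 v) \<le> B * norm v"
    by (simp_all add: B_def norm_blinfun)
  \<comment> \<open>The factors come from the norm of \<open>J 0\<close> in the coordinates, the
    squared Hoelder constant, and the bound of a norm by \<open>DIM('a)\<close> times its largest
    coordinate.\<close>
  define K where "K = (1 + B\<^sup>2) * C\<^sup>2 * DIM('a)"
  have "K > 0" using B(1) by (auto simp: K_def C_def intro!: mult_pos_pos add_pos_nonneg)
  define A where "A = max 16 (max (816 * K) (16384 * sup_step_const K DIM('a)))"
  have A: "816 * K \<le> A" "16384 * sup_step_const K DIM('a) \<le> A" "16 \<le> A"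
    by (simp_all add: A_def)
  define \<eta> where "\<eta> = 1 / A"
  have \<eta>: "0 < \<eta>" "16 * \<eta> \<le> 1" "816 * K * \<eta> \<le> 1" "16384 * sup_step_const K DIM('a) * \<eta> \<le> 1"
    using A by (simp_all add: \<eta>_def)
  \<comment> \<open>Passing to the coordinates enlarges norms by at most the factor
    \<open>1 + B\<close>.\<close>
  define \<eta>' where "\<eta>' = \<eta> / (1 + B)"
  have "\<eta>' > 0" "(1 + B) * \<eta>' = \<eta>" using \<eta>(1) B(1) by (simp_all add: \<eta>'_def)
  have "open (S \<inter> u -` U)" "open (S \<inter> ux -` ball 0 \<eta>')" "open (S \<inter> uy -` ball 0 \<eta>')"
    by (intro continuous_open_preimage cont \<open>open S\<close> U(1) open_ball)+
  then have "open ((S \<inter> u -` U) \<inter> (S \<inter> ux -` ball 0 \<eta>') \<inter> (S \<inter> uy -` ball 0 \<eta>'))"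
    by (rule open_Int[OF open_Int])
  moreover have "p \<in> (S \<inter> u -` U) \<inter> (S \<inter> ux -` ball 0 \<eta>') \<inter> (S \<inter> uy -` ball 0 \<eta>')"
    using p(1) \<open>u p = 0\<close> \<open>ux p = 0\<close> \<open>uy p = 0\<close> U(2) \<open>\<eta>' > 0\<close> by simp
  ultimately obtain r0 where r0: "r0 > 0"
    "ball p r0 \<subseteq> (S \<inter> u -` U) \<inter> (S \<inter> ux -` ball 0 \<eta>') \<inter> (S \<inter> uy -` ball 0 \<eta>')"
    using openE by blast
  define r where "r = min r0 1"
  have r: "r > 0" "r \<le> 1" using r0(1) by (auto simp: r_def)
  have near: "z \<in> S" "u z \<in> U" "norm (ux z) < \<eta>'" "norm (uy z) < \<eta>'" if "z \<in> ball p r" for z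
    using that r0(2) by (auto simp: r_def)
  \<comment> \<open>Since \<open>p\<close> is not in \<open>Z\<close>, the radius \<open>R\<close>
    below is at most the distance from \<open>q\<close> to \<open>p\<close>; the bound r/4 then puts
    the doubled disc inside \<open>ball p r\<close>.\<close>
  obtain q where q: "q \<in> Z" "dist q p < r / 4"
    using p(2) r(1) by (meson closure_approachable divide_pos_pos zero_less_numeral)
  define R where "R = infdist q (- Z)"
  have ne: "- Z \<noteq> {}" and cl: "closed (- Z)" using \<open>p \<notin> Z\<close> \<open>open Z\<close> by auto
  obtain x where x: "x \<in> - Z" "R = dist q x"
    unfolding R_def using infdist_attains_inf[OF cl ne] by blast
  have "R > 0" using x q(1) by auto
  have "R < r / 4"
    using infdist_le[of p "- Z" q] \<open>p \<notin> Z\<close> q(2) by (simp add: R_def)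
  have ball_R: "ball q R \<subseteq> Z"
    using infdist_le[of _ "- Z" q] unfolding R_def by fastforce
  have ball_2R: "ball q (2 * R) \<subseteq> ball p r"
    using \<open>R < r / 4\<close> q(2) by (intro ball_subset_ball_iff[THEN iffD2]) (auto simp: dist_commute)
  let ?c = "complex_coord (J 0)"
  have coord: "?c b v = 0 \<longleftrightarrow> v \<bullet> b = 0 \<and> J 0 v \<bullet> b = 0" for b v
    by (simp add: complex_coord_def complex_eq_iff)
  have coord_le: "cmod (?c b v) \<le> (1 + B) * norm v" if "b \<in> Basis" for b v
  proof -
    have "cmod (?c b v) \<le> \<bar>v \<bullet> b\<bar> + \<bar>J 0 v \<bullet> b\<bar>"
      using cmod_le[of "?c b v"] by (simp add: complex_coord_def)
    also have "\<dots> \<le> norm v + norm (J 0 v)"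
      using that by (intro add_mono Basis_le_norm)
    finally show ?thesis using B(2)[of v] by (simp add: algebra_simps)
  qed
  have vanish: "?c b (u z) = 0" if "b \<in> Basis" "z \<in> ball q (3 / 2 * R)" for b z
  proof (rule vanishes_on_larger_disc[of Basis K q R "\<lambda>b z. ?c b (u z)" "\<lambda>b z. ?c b (ux z)" "\<lambda>b z. ?c b (uy z)" \<eta>])
    have "partials_on (ball q (2 * R)) u ux uy"
      using u by (rule partials_on_subset) (use ball_2R near(1) in auto)
    then show "partials_on (ball q (2 * R)) (\<lambda>z. ?c b (u z)) (\<lambda>z. ?c b (ux z)) (\<lambda>z. ?c b (uy z))" for b
      by (rule partials_on_bounded_linear[OF bounded_linear_complex_coord])
    show "?c b (u z) = 0" if "z \<in> ball q R" for b z
      using Z_u ball_R that by (auto simp: coord)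
    show "cmod (?c b (ux z)) \<le> \<eta>" "cmod (?c b (uy z)) \<le> \<eta>" if "b \<in> Basis" "z \<in> ball q (2 * R)" for b z
    proof -
      have "norm (ux z) \<le> \<eta>'" "norm (uy z) \<le> \<eta>'" using near(3,4)[of z] ball_2R that(2) by force+
      then have "(1 + B) * norm (ux z) \<le> \<eta>" "(1 + B) * norm (uy z) \<le> \<eta>"
        unfolding \<open>(1 + B) * \<eta>' = \<eta>\<close>[symmetric] using B(1) by (auto intro!: mult_left_mono)
      then show "cmod (?c b (ux z)) \<le> \<eta>" "cmod (?c b (uy z)) \<le> \<eta>"
        using coord_le[OF that(1)] order_trans by blast+
    qed
    show "(\<Sum>b\<in>Basis. (cmod (?c b (uy z) - \<i> * ?c b (ux z)))\<^sup>2)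
        \<le> K * M * (\<Sum>b\<in>Basis. (cmod (?c b (ux z)))\<^sup>2)"
      if z: "z \<in> ball q (2 * R)" and M: "\<And>b. b \<in> Basis \<Longrightarrow> cmod (?c b (u z)) \<le> M" for M z
    proof -
      have zp: "z \<in> ball p r" using ball_2R z by blast
      \<comment> \<open>\<open>e\<close> is the defect in the equation for the constant structure
        \<open>J 0\<close>, that is, \<open>J (u z) - J 0\<close> applied to
        \<open>ux z\<close>.\<close>
      define e where "e = uy z - J 0 (ux z)"
      have "norm e \<le> norm (J (u z) - J 0) * norm (ux z)"
        unfolding e_def Ju[OF near(1)[OF zp]] blinfun.diff_left[symmetric] by (rule norm_blinfun)
      also have "\<dots> \<le> C * norm (u z) powr (1 / 2) * norm (ux z)"
        by (intro mult_right_mono C near(2)[OF zp]) auto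
      finally have "(norm e)\<^sup>2 \<le> (C * norm (u z) powr (1 / 2) * norm (ux z))\<^sup>2"
        by (rule power_mono) simp
      \<comment> \<open>Squaring turns the Hoelder exponent 1/2 into the first power of |u|, the
        form in which the differential inequality was assumed.\<close>
      also have "\<dots> = C\<^sup>2 * norm (u z) * (norm (ux z))\<^sup>2"
        by (simp add: power_mult_distrib powr_half_sqrt)
      finally have e: "(norm e)\<^sup>2 \<le> C\<^sup>2 * norm (u z) * (norm (ux z))\<^sup>2" .
      have "norm (u z) \<le> (\<Sum>b\<in>Basis. \<bar>u z \<bullet> b\<bar>)" by (rule norm_le_l1)
      also have "\<dots> \<le> (\<Sum>b\<in>(Basis :: 'a set). M)"
      proof (rule sum_mono)
        show "\<bar>u z \<bullet> b\<bar> \<le> M" if "b \<in> Basis" for b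
          using M[OF that] abs_Re_le_cmod[of "?c b (u z)"] by (simp add: complex_coord_def)
      qed
      finally have uM: "norm (u z) \<le> DIM('a) * M" by simp
      have "?c b (uy z) - \<i> * ?c b (ux z) = ?c b e" for b
        unfolding e_def complex_coord_J[OF J, symmetric]
        by (rule linear_diff[OF bounded_linear.linear[OF bounded_linear_complex_coord], symmetric])
      then have "(\<Sum>b\<in>Basis. (cmod (?c b (uy z) - \<i> * ?c b (ux z)))\<^sup>2) = (norm e)\<^sup>2 + (norm (J 0 e))\<^sup>2"
        by (simp add: sum_cmod_complex_coord)
      also have "\<dots> \<le> (norm e)\<^sup>2 + (B * norm e)\<^sup>2"
        using B(2) by (intro add_left_mono power_mono) auto
      also have "\<dots> = (1 + B\<^sup>2) * (norm e)\<^sup>2" by (simp add: algebra_simps)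
      also have "\<dots> \<le> (1 + B\<^sup>2) * (C\<^sup>2 * norm (u z) * (norm (ux z))\<^sup>2)"
        using e by (intro mult_left_mono) auto
      also have "\<dots> \<le> (1 + B\<^sup>2) * (C\<^sup>2 * (DIM('a) * M) * (norm (ux z))\<^sup>2)"
        using uM by (intro mult_left_mono mult_right_mono) auto
      also have "\<dots> = K * M * (norm (ux z))\<^sup>2" by (simp add: K_def)
      also have "\<dots> \<le> K * M * (\<Sum>b\<in>Basis. (cmod (?c b (ux z)))\<^sup>2)"
      proof (rule mult_left_mono)
        have "M \<ge> 0" using M order_trans[OF norm_ge_zero] SOME_Basis by blast
        then show "0 \<le> K * M" using \<open>K > 0\<close> by simp
      qed (simp add: sum_cmod_complex_coord)
      finally show ?thesis .
    qed
  qed (use that \<eta> \<open>K > 0\<close> \<open>R > 0\<close> \<open>R < r / 4\<close> r in auto)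
  have "u z = 0" if "z \<in> ball q (3 / 2 * R)" for z
  proof (rule euclidean_eqI)
    show "u z \<bullet> b = 0 \<bullet> b" if "b \<in> Basis" for b
      using vanish[OF that \<open>z \<in> ball q (3 / 2 * R)\<close>] by (simp add: coord)
  qed
  moreover have "ball q (3 / 2 * R) \<subseteq> S"
  proof
    fix z assume "z \<in> ball q (3 / 2 * R)"
    then have "z \<in> ball q (2 * R)" using \<open>R > 0\<close> by simp
    then show "z \<in> S" using ball_2R near(1) by blast
  qed
  ultimately have "ball q (3 / 2 * R) \<subseteq> Z"
    unfolding Z by (intro interior_maximal) auto
  moreover have "x \<in> ball q (3 / 2 * R)" using x(2) \<open>R > 0\<close> by simp
  ultimately show False using x(1) by blast
qed

theorem proposition1:
  fixes J :: "complex ^ 'n \<Rightarrow> (complex ^ 'n) \<Rightarrow>\<^sub>L (complex ^ 'n)"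
    and u :: "complex \<Rightarrow> complex ^ 'n"
    and W :: "complex set"
  assumes "almost_complex_structure J"
    and "locally_holder_on (1/2) UNIV J"
    and "J_holomorphic_on J (ball 0 1) u"
    and "open W" and "W \<noteq> {}" and "W \<subseteq> ball 0 1"
    and "\<forall>z\<in>W. u z = 0"
  shows "\<forall>z\<in>ball 0 1. u z = 0"
proof -
  obtain u' :: "complex \<Rightarrow> complex \<Rightarrow>\<^sub>L (complex ^ 'n)"
    where u': "\<And>z. z \<in> ball 0 1 \<Longrightarrow> (u has_derivative u' z) (at z)" "continuous_on (ball 0 1) u'"
    using assms(3) unfolding J_holomorphic_on_def C1_on_def by blast
  define ux where "ux z = u' z 1" for z
  define uy where "uy z = u' z \<i>" for z
  have u'_eq: "blinfun_apply (u' z) = (\<lambda>h. Re h *\<^sub>R ux z + Im h *\<^sub>R uy z)" for z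
  proof
    fix h
    have "h = Re h *\<^sub>R 1 + Im h *\<^sub>R \<i>" by (simp add: complex_eq_iff)
    then show "u' z h = Re h *\<^sub>R ux z + Im h *\<^sub>R uy z"
      unfolding ux_def uy_def by (metis blinfun.add_right blinfun.scaleR_right)
  qed
  have u: "partials_on (ball 0 1) u ux uy"
    unfolding partials_on_def
  proof (intro conjI ballI)
    show "(u has_derivative (\<lambda>h. Re h *\<^sub>R ux z + Im h *\<^sub>R uy z)) (at z)" if "z \<in> ball 0 1" for z
      using u'(1)[OF that] unfolding u'_eq .
    show "continuous_on (ball 0 1) ux" "continuous_on (ball 0 1) uy"
      unfolding ux_def[abs_def] uy_def[abs_def]
      by (intro blinfun.continuous_on u'(2) continuous_on_const)+
  qed
  \<comment> \<open>Both partial derivatives of the definition are directional derivatives of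
    \<open>u\<close>, in the directions 1 and \<open>\<i>\<close>.\<close>
  have along: "vector_derivative (\<lambda>t. u (z + of_real t * d)) (at 0) = u' z d" if "z \<in> ball 0 1" for z d
  proof (rule vector_derivative_at)
    have 1: "((\<lambda>t. z + of_real t * d) has_derivative (\<lambda>t. of_real t * d)) (at 0)"
      by (auto intro!: derivative_eq_intros)
    have 2: "(u has_derivative u' z) (at (z + of_real 0 * d))"
      using u'(1)[OF that] by simp
    show "((\<lambda>t. u (z + of_real t * d)) has_vector_derivative u' z d) (at 0)"
      using has_derivative_compose[OF 1 2]
      by (simp add: has_vector_derivative_def blinfun.scaleR_right flip: scaleR_conv_of_real)
  qed
  have Ju: "uy z = J (u z) (ux z)" if "z \<in> ball 0 1" for z
    using assms(3) that along[OF that, of 1] along[OF that, of \<i>]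
    by (simp add: J_holomorphic_on_def partial_x_def partial_y_def ux_def uy_def mult.commute)
  have J: "J q (J q v) = - v" for q v
    using assms(1) unfolding almost_complex_structure_def
    by (metis blinfun_apply_blinfun_compose blinfun.minus_left id_blinfun.rep_eq id_apply)
  \<comment> \<open>\<open>Z\<close> is nonempty, open and relatively closed, so it fills the
    connected disc.\<close>
  define Z where "Z = interior {z \<in> ball 0 1. u z = 0}"
  have "W \<subseteq> Z"
    unfolding Z_def using assms(4,6,7) by (intro interior_maximal) auto
  have "Z \<subseteq> ball 0 1" unfolding Z_def using interior_subset by blast
  moreover have "openin (top_of_set (ball 0 1)) Z"
    using \<open>Z \<subseteq> ball 0 1\<close> by (intro openin_open_Int[of Z "ball 0 1", THEN back_subst[of "openin _"]]) (auto simp: Z_def)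
  moreover have "closedin (top_of_set (ball 0 1)) Z"
  proof -
    have "Z = ball 0 1 \<inter> closure Z"
      using interior_zeros_relatively_closed[OF J assms(2) u open_ball Ju Z_def] \<open>Z \<subseteq> ball 0 1\<close>
        closure_subset by blast
    then show ?thesis using closedin_closed by blast
  qed
  ultimately have "Z = ball 0 1"
    using connected_clopen[of "ball (0::complex) 1"] assms(5) \<open>W \<subseteq> Z\<close> by (metis connected_ball subset_empty)
  then show ?thesis
    unfolding Z_def using interior_subset by blast
qed

end
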